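(* Under the setting below, the stochastic game among the $N$ prosumers with payoffs $V_i$ admits a stationary Nash equilibrium: there is a profile of stationary policies $\boldsymbol{\Psi}^*=(\Psi_1^*,\dots,\Psi_N^* )$ such that for every $i\in\{1,\dots,N\}$ and every (possibly history-dependent, randomized) policy $\theta_i$ of prosumer $i$, $$V_i(\Psi_i^*,\boldsymbol{\Psi}^*_{-i})\ \ge\ V_i(\theta_i,\boldsymbol{\Psi}^*_{-i}).$$
   Context: There are $N$ prosumers. Prosumer $i$ has state set $\mathcal{S}_i=\{0,\dots,S_i^{\max}\}$, action set $\mathcal{A}_i=\mathcal{L}_i\times\mathcal{D}_i$ with $\mathcal{L}_i=\{0,\dots,L_i^{\max}\}$, $\mathcal{D}_i=\{0,\dots,D_i^{\max}\}$, and state dynamics $S_i(t+1)=\min\{[S_i(t)+G_i(t)+D_i(t)-L_i(t)]^+,S_i^{\max}\}$ where $A_i(t)=(L_i(t),D_i(t))$, $[x]^+=\max\{0,x\}$, and in state $s$ only actions $(l,d)$ with $0\le s+d-l\le S_i^{\max}$ are taken. The processes $(G_i(t))_{t\ge1}$, $i=1,\dots,N$, are mutually independent, each i.i.d. and $\mathbb{Z}$-valued with law $G_i$, and $\lambda_i:=\min_{|k|\le S_i^{\max}}\mathbb{P}\{G_i=k\}>0$ for all $i$. Each prosumer's state evolves only according to its own actions and generated energy, so under a profile of policies the state-action processes of different prosumers are independent. A policy of prosumer $i$ is a sequence of (possibly history-dependent) probability distributions over $\mathcal{A}_i$ used to draw $A_i(t)$; a policy is stationary if the action is drawn from a distribution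 $\Psi_i(\cdot\mid S_i(t))$ depending only on the current state. For a profile $\boldsymbol{a}=(a_1,\dots,a_N)$ of actions, $U_i(\boldsymbol{a})\in\mathbb{R}$ is prosumer $i$'s instantaneous payoff (in the paper $U_i(\boldsymbol a)=f_i(l_i)-d_i\,p_i(d_1,\dots,d_N)$ with $f_i$ increasing and $p_i$ a price function; any real function of $\boldsymbol a$ is allowed). Each prosumer has a continuous weighting function $w_i:[0,1]\to\mathbb{R}$ and a valuation function $v_i:\mathbb{R}\to\mathbb{R}$ (prospect theory). Writing $\mathbb{P}_t^{\theta}(s,a):=\mathbb{P}^{\theta}\{S(t)=s,A(t)=a\}$ for the joint state-action law of a prosumer at time $t$ under its policy $\theta$, the (prospect) payoff of prosumer $i$ when it uses policy $\theta_i$ and the others use stationary policies $\boldsymbol{\Psi}_{-i}$ is $$V_i(\theta_i,\boldsymbol{\Psi}_{-i})=\limsup_{T\to\infty}\frac1T\sum_{t=1}^T\sum_{(\boldsymbol{s},\boldsymbol{a})}\mathbb{P}^{\theta_i}_t(s_i,a_i)\,w_i\Big(\prod_{j\ne i}\mathbb{P}^{\Psi_j}_t(s_j,a_j)\Big)\,v_i\big(U_i(\boldsymbol a)\big),$$ the sum ranging over all joint states $\boldsymbol s\in\prod_j\mathcal{S}_j$ and joint actions $\boldsymbol a\in\prod_j\mathcal{A}_j$. *)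

theory Defs
  imports "HOL-Probability.Probability" "HOL-Library.FuncSet"
begin

text \<open>A history at time t: the list of past (state, action) pairs together with the
current state. Actions are pairs (l, d). States and action components are naturals.\<close>
type_synonym hist = "(nat \<times> (nat \<times> nat)) list \<times> nat"

definition feasible :: "nat \<Rightarrow> nat \<Rightarrow> nat \<Rightarrow> nat \<Rightarrow> (nat \<times> nat) set" where
  "feasible Smax Lmax Dmax s =
     {(l, d). l \<le> Lmax \<and> d \<le> Dmax \<and> l \<le> s + d \<and> s + d \<le> Smax + l}"

definition next_state :: "nat \<Rightarrow> nat \<Rightarrow> nat \<times> nat \<Rightarrow> int \<Rightarrow> nat" where
  "next_state Smax s a g = nat (min (max 0 (int s + g + int (snd a) - int (fst a))) (int Smax))"

text \<open>Law of the history at time t+1 under a (history-dependent) policy theta,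
initial state law mu and generation law G.\<close>
fun hist_law :: "nat pmf \<Rightarrow> int pmf \<Rightarrow> nat \<Rightarrow> (hist \<Rightarrow> (nat \<times> nat) pmf) \<Rightarrow> nat \<Rightarrow> hist pmf" where
  "hist_law mu G Smax \<theta> 0 = map_pmf (\<lambda>s. ([], s)) mu"
| "hist_law mu G Smax \<theta> (Suc t) =
     bind_pmf (hist_law mu G Smax \<theta> t) (\<lambda>(h, s).
       bind_pmf (\<theta> (h, s)) (\<lambda>a.
         map_pmf (\<lambda>g. (h @ [(s, a)], next_state Smax s a g)) G))"

text \<open>Joint state-action law (S(t), A(t)) at time t >= 1.\<close>
definition sa_law :: "nat pmf \<Rightarrow> int pmf \<Rightarrow> nat \<Rightarrow> (hist \<Rightarrow> (nat \<times> nat) pmf) \<Rightarrow> nat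
    \<Rightarrow> (nat \<times> (nat \<times> nat)) pmf" where
  "sa_law mu G Smax \<theta> t =
     bind_pmf (hist_law mu G Smax \<theta> (t - 1)) (\<lambda>(h, s). map_pmf (\<lambda>a. (s, a)) (\<theta> (h, s)))"

definition sa_prob :: "nat pmf \<Rightarrow> int pmf \<Rightarrow> nat \<Rightarrow> (hist \<Rightarrow> (nat \<times> nat) pmf) \<Rightarrow> nat
    \<Rightarrow> nat \<times> (nat \<times> nat) \<Rightarrow> real" where
  "sa_prob mu G Smax \<theta> t x = pmf (sa_law mu G Smax \<theta> t) x"

definition stationary :: "(nat \<Rightarrow> (nat \<times> nat) pmf) \<Rightarrow> (hist \<Rightarrow> (nat \<times> nat) pmf)" where
  "stationary \<Psi> = (\<lambda>(h, s). \<Psi> s)"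

definition valid_policy :: "nat \<Rightarrow> nat \<Rightarrow> nat \<Rightarrow> (hist \<Rightarrow> (nat \<times> nat) pmf) \<Rightarrow> bool" where
  "valid_policy Smax Lmax Dmax \<theta> \<longleftrightarrow>
     (\<forall>h s. s \<le> Smax \<longrightarrow> set_pmf (\<theta> (h, s)) \<subseteq> feasible Smax Lmax Dmax s)"

definition valid_stationary :: "nat \<Rightarrow> nat \<Rightarrow> nat \<Rightarrow> (nat \<Rightarrow> (nat \<times> nat) pmf) \<Rightarrow> bool" where
  "valid_stationary Smax Lmax Dmax \<Psi> \<longleftrightarrow>
     (\<forall>s. s \<le> Smax \<longrightarrow> set_pmf (\<Psi> s) \<subseteq> feasible Smax Lmax Dmax s)"

definition state_actions :: "nat \<Rightarrow> nat \<Rightarrow> nat \<Rightarrow> (nat \<times> (nat \<times> nat)) set" where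
  "state_actions Smax Lmax Dmax = {(s, (l, d)). s \<le> Smax \<and> l \<le> Lmax \<and> d \<le> Dmax}"

text \<open>Prospect payoff V_i(theta_i, Psi_{-i}); prosumers are indexed by 0..N-1.
U i maps an action profile (function on {..<N}) to a real payoff.\<close>
definition prospect_payoff ::
  "nat \<Rightarrow> (nat \<Rightarrow> nat) \<Rightarrow> (nat \<Rightarrow> nat) \<Rightarrow> (nat \<Rightarrow> nat) \<Rightarrow> (nat \<Rightarrow> nat pmf) \<Rightarrow> (nat \<Rightarrow> int pmf)
   \<Rightarrow> (nat \<Rightarrow> (nat \<Rightarrow> nat \<times> nat) \<Rightarrow> real) \<Rightarrow> (nat \<Rightarrow> real \<Rightarrow> real) \<Rightarrow> (nat \<Rightarrow> real \<Rightarrow> real)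
   \<Rightarrow> nat \<Rightarrow> (hist \<Rightarrow> (nat \<times> nat) pmf) \<Rightarrow> (nat \<Rightarrow> nat \<Rightarrow> (nat \<times> nat) pmf) \<Rightarrow> ereal" where
  "prospect_payoff N Smax Lmax Dmax mu G U w v i \<theta> \<Psi> =
     limsup (\<lambda>T. ereal ((1 / real T) * (\<Sum>t = 1..T.
       \<Sum>x \<in> PiE {..<N} (\<lambda>j. state_actions (Smax j) (Lmax j) (Dmax j)).
         sa_prob (mu i) (G i) (Smax i) \<theta> t (x i)
         * w i (\<Prod>j \<in> {..<N} - {i}. sa_prob (mu j) (G j) (Smax j) (stationary (\<Psi> j)) t (x j))
         * v i (U i (restrict (\<lambda>j. snd (x j)) {..<N})))))"

end

theory Submission
  imports Defs
begin

text \<open>Every state is reachable in one step with probability at least \<open>lam\<close>, whatever the action.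
  So for fixed opponents the average-reward problem of a player has a Poisson equation
  \<open>\<gamma> + h s = \<Sum>a. \<psi> s a * (r s a + \<Sum>s'. P s a s' * h s')\<close>; with \<open>P - lam\<close> in place of \<open>P\<close> it becomes
  a contraction (a discounted problem), and \<open>\<gamma> = lam * (\<Sum>s. h s)\<close>. Let Nash's improvement map act on
  the policies \<open>\<psi>\<close>, jointly with the maps whose fixed points are the stationary laws \<open>\<rho>\<close> and the
  relative values \<open>h\<close>. A fixed point is a profile in which no action improves on \<open>h\<close>; telescoping
  \<open>h\<close> along a trajectory bounds the payoff of every history-dependent policy by \<open>\<gamma>\<close>, the payoff of
  \<open>\<psi>\<close>. By Doeblin's argument the opponents' laws converge to the stationary ones, so only the
  limiting rewards matter.

  As the number of coordinates is not fixed by the types, the fixed point comes from the Hilbert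
  cube.\<close>

section \<open>Fixed points in the Hilbert cube\<close>

text \<open>Leaving the index type open, with the product topology on functions, covers the
  finite-dimensional cubes and the Hilbert cube alike.\<close>

definition unit_cube :: "('a \<Rightarrow> real) set" where
  "unit_cube = {x. \<forall>i. 0 \<le> x i \<and> x i \<le> 1}"

lemma compact_unit_cube: "compact (unit_cube :: ('a \<Rightarrow> real) set)"
proof -
  have "unit_cube = PiE UNIV (\<lambda>_::'a. {0..1::real})"
    by (auto simp: unit_cube_def)
  then show ?thesis
    by (metis compactin_PiE compactin_euclidean_iff compact_Icc euclidean_product_topology)
qed

lemma tendsto_fun_iff:
  fixes X :: "'b \<Rightarrow> 'a \<Rightarrow> 'c::topological_space"
  shows "(X \<longlongrightarrow> x) F \<longleftrightarrow> (\<forall>i. ((\<lambda>n. X n i) \<longlongrightarrow> x i) F)"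
  using limitin_componentwise[of "\<lambda>_. euclidean" UNIV X x F]
  by (simp add: euclidean_product_topology)

text \<open>Kuhn's lemma is applied with the same \<open>p\<close> for the dimension and the mesh; a fully labelled cell
  for \<open>p\<close> then controls the first \<open>p\<close> coordinates, and compactness gives the limit.\<close>

lemma hilbert_cube_fixed_point_nat:
  fixes f :: "(nat \<Rightarrow> real) \<Rightarrow> nat \<Rightarrow> real"
  assumes cont: "continuous_on unit_cube f"
    and into: "\<And>x. x \<in> unit_cube \<Longrightarrow> f x \<in> unit_cube"
  obtains x where "x \<in> unit_cube" "f x = x"
proof -
  \<comment> \<open>Grid points of mesh \<open>1 / p\<close> in the first \<open>p\<close>
    coordinates; padding with zeros places them in the infinite-dimensional cube, where
    \<open>f\<close> can be evaluated.\<close>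
  define e where "e p x = (\<lambda>i. if i < p then real (x i) / real p else 0)" for p and x :: "nat \<Rightarrow> nat"
  have e_cube: "e p x \<in> unit_cube" if "0 < p" "\<forall>i<p. x i \<le> p" for p x
    using that by (auto simp: e_def unit_cube_def field_simps)
  have "\<exists>q. \<forall>i<p. q i < p \<and>
      (\<exists>r s. (\<forall>j<p. q j \<le> r j \<and> r j \<le> q j + 1) \<and> (\<forall>j<p. q j \<le> s j \<and> s j \<le> q j + 1) \<and>
        e p r i \<le> f (e p r) i \<and> f (e p s) i \<le> e p s i)" if p: "0 < p" for p
  proof -
    \<comment> \<open>Label 0 records that \<open>f\<close> does not decrease coordinate
      \<open>i\<close>, label 1 that it does not increase it. Kuhn's lemma dictates the labels on
      the two opposite faces, and there these inequalities hold because \<open>f\<close> stays in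
      the cube.\<close>
    define label where "label x i =
      (if x i = 0 then 0 else if x i = p then 1 else if e p x i \<le> f (e p x) i then 0 else 1::nat)" for x i
    have lab0: "e p x i \<le> f (e p x) i" if "\<forall>i<p. x i \<le> p" "i < p" "label x i = 0" for x i
      using that into[OF e_cube[OF p that(1)]]
      by (auto simp: label_def unit_cube_def e_def split: if_splits)
    have lab1: "f (e p x) i \<le> e p x i" if "\<forall>i<p. x i \<le> p" "i < p" "label x i \<noteq> 0" for x i
      using that into[OF e_cube[OF p that(1)]]
      by (auto simp: label_def unit_cube_def e_def split: if_splits)
    obtain q where q: "\<forall>i<p. q i < p"
      and rs: "\<forall>i<p. \<exists>r s. (\<forall>j<p. q j \<le> r j \<and> r j \<le> q j + 1) \<and>
                 (\<forall>j<p. q j \<le> s j \<and> s j \<le> q j + 1) \<and> label r i \<noteq> label s i"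
      by (rule kuhn_lemma[OF p, of p label]) (auto simp: label_def)
    show ?thesis
    proof (rule exI[of _ q], intro allI impI conjI)
      fix i assume i: "i < p"
      obtain r s where r: "\<forall>j<p. q j \<le> r j \<and> r j \<le> q j + 1"
        and s: "\<forall>j<p. q j \<le> s j \<and> s j \<le> q j + 1" and "label r i \<noteq> label s i"
        using rs i by blast
      moreover from r s q have "\<forall>i<p. r i \<le> p" "\<forall>i<p. s i \<le> p" by force+
      moreover have "label r i = 0 \<and> label s i \<noteq> 0 \<or> label s i = 0 \<and> label r i \<noteq> 0"
        using \<open>label r i \<noteq> label s i\<close> p by (auto simp: label_def split: if_splits)
      ultimately show "\<exists>r s. (\<forall>j<p. q j \<le> r j \<and> r j \<le> q j + 1) \<and>
          (\<forall>j<p. q j \<le> s j \<and> s j \<le> q j + 1) \<and> e p r i \<le> f (e p r) i \<and> f (e p s) i \<le> e p s i"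
        using lab0 lab1 i by metis
    qed (use q in auto)
  qed
  then have "\<forall>p. \<exists>q. 0 < p \<longrightarrow> (\<forall>i<p. q i < p \<and>
      (\<exists>r s. (\<forall>j<p. q j \<le> r j \<and> r j \<le> q j + 1) \<and> (\<forall>j<p. q j \<le> s j \<and> s j \<le> q j + 1) \<and>
        e p r i \<le> f (e p r) i \<and> f (e p s) i \<le> e p s i))" by blast
  then obtain q where q: "\<And>p i. 0 < p \<Longrightarrow> i < p \<Longrightarrow> q p i < p \<and>
      (\<exists>r s. (\<forall>j<p. q p j \<le> r j \<and> r j \<le> q p j + 1) \<and> (\<forall>j<p. q p j \<le> s j \<and> s j \<le> q p j + 1) \<and>
        e p r i \<le> f (e p r) i \<and> f (e p s) i \<le> e p s i)" by metis
  \<comment> \<open>Base corners of the fully labelled cells; \<open>Suc n\<close> keeps the mesh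
    well defined.\<close>
  define X where "X n = e (Suc n) (q (Suc n))" for n
  have "X n \<in> unit_cube" for n
    unfolding X_def by (rule e_cube) (use q in \<open>auto intro: less_imp_le\<close>)
  then obtain x \<phi> where x: "x \<in> unit_cube" and \<phi>: "strict_mono \<phi>" and lim: "(X \<circ> \<phi>) \<longlonglongrightarrow> x"
    using compact_unit_cube[where 'a = nat] unfolding compact_eq_seq_compact_metric
    by (blast elim: seq_compactE)
  \<comment> \<open>Every choice of points from the cells has the limit of their base corners, since
    each coordinate moves by at most one mesh width and the mesh shrinks to 0.\<close>
  have near: "(\<lambda>n. e (Suc (\<phi> n)) (R n)) \<longlonglongrightarrow> x"
    if R: "eventually (\<lambda>n. \<forall>j<Suc (\<phi> n). q (Suc (\<phi> n)) j \<le> R n j \<and> R n j \<le> q (Suc (\<phi> n)) j + 1) sequentially" for R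
    unfolding tendsto_fun_iff
  proof
    fix j
    have 1: "(\<lambda>n. X (\<phi> n) j) \<longlonglongrightarrow> x j"
      using lim by (simp add: tendsto_fun_iff)
    have 2: "(\<lambda>n. 1 / real (Suc (\<phi> n))) \<longlonglongrightarrow> 0"
      using LIMSEQ_subseq_LIMSEQ[OF lim_1_over_n[THEN LIMSEQ_Suc] \<phi>] by (simp add: o_def)
    have "eventually (\<lambda>n. norm (e (Suc (\<phi> n)) (R n) j - X (\<phi> n) j) \<le> 1 / real (Suc (\<phi> n))) sequentially"
      using R
    proof eventually_elim
      case (elim n)
      show ?case
      proof (cases "j < Suc (\<phi> n)")
        case True
        have "real (R n j) - real (q (Suc (\<phi> n)) j) \<le> 1" "0 \<le> real (R n j) - real (q (Suc (\<phi> n)) j)"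
          using elim[rule_format, OF True] by linarith+
        then have "\<bar>real (R n j) - real (q (Suc (\<phi> n)) j)\<bar> / real (Suc (\<phi> n)) \<le> 1 / real (Suc (\<phi> n))"
          by (intro divide_right_mono) auto
        moreover have "e (Suc (\<phi> n)) (R n) j - X (\<phi> n) j
            = (real (R n j) - real (q (Suc (\<phi> n)) j)) / real (Suc (\<phi> n))"
          using True by (simp only: X_def e_def if_True diff_divide_distrib)
        ultimately show ?thesis by (simp only: real_norm_def abs_divide abs_of_nat)
      qed (simp add: X_def e_def)
    qed
    from Lim_null_comparison[OF this 2] show "(\<lambda>n. e (Suc (\<phi> n)) (R n) j) \<longlonglongrightarrow> x j"
      by (rule Lim_transform[OF 1])
  qed
  have "f x i = x i" for i
  proof -
    \<comment> \<open>Labels control only the first \<open>Suc (\<phi> n)\<close> coordinates; since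
      \<open>\<phi> n\<close> is at least \<open>n\<close>, coordinate \<open>i\<close> is
      eventually among them.\<close>
    have ev: "eventually (\<lambda>n. i < Suc (\<phi> n)) sequentially"
      using eventually_gt_at_top[of i]
    proof eventually_elim
      case (elim n)
      then show ?case using seq_suble[OF \<phi>, of n] by simp
    qed
    define good where "good n r s \<longleftrightarrow> (\<forall>j<Suc (\<phi> n). q (Suc (\<phi> n)) j \<le> r j \<and> r j \<le> q (Suc (\<phi> n)) j + 1) \<and>
       (\<forall>j<Suc (\<phi> n). q (Suc (\<phi> n)) j \<le> s j \<and> s j \<le> q (Suc (\<phi> n)) j + 1) \<and>
        e (Suc (\<phi> n)) r i \<le> f (e (Suc (\<phi> n)) r) i \<and> f (e (Suc (\<phi> n)) s) i \<le> e (Suc (\<phi> n)) s i" for n r s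
    have "\<exists>r s. good n r s" if "i < Suc (\<phi> n)" for n
      using q[OF zero_less_Suc that] unfolding good_def by blast
    then obtain r s where rs: "\<And>n. i < Suc (\<phi> n) \<Longrightarrow> good n (r n) (s n)" by metis
    have ev_good: "eventually (\<lambda>n. good n (r n) (s n)) sequentially"
      using ev by eventually_elim (rule rs)
    have coord: "(\<lambda>n. f (e (Suc (\<phi> n)) (R n)) i) \<longlonglongrightarrow> f x i \<and> (\<lambda>n. e (Suc (\<phi> n)) (R n) i) \<longlonglongrightarrow> x i"
      if R: "eventually (\<lambda>n. \<forall>j<Suc (\<phi> n). q (Suc (\<phi> n)) j \<le> R n j \<and> R n j \<le> q (Suc (\<phi> n)) j + 1) sequentially" for R
    proof -
      note n = near[OF R]
      have "eventually (\<lambda>n. e (Suc (\<phi> n)) (R n) \<in> unit_cube) sequentially"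
        using R
      proof eventually_elim
        case (elim n)
        have "R n j \<le> Suc (\<phi> n)" if "j < Suc (\<phi> n)" for j
          using elim[rule_format, OF that] q[OF zero_less_Suc that] by linarith
        then show ?case
          by (intro e_cube) auto
      qed
      then have "(\<lambda>n. f (e (Suc (\<phi> n)) (R n))) \<longlonglongrightarrow> f x"
        by (rule continuous_on_tendsto_compose[OF cont n x])
      with n show ?thesis by (simp add: tendsto_fun_iff)
    qed
    have "eventually (\<lambda>n. \<forall>j<Suc (\<phi> n). q (Suc (\<phi> n)) j \<le> r n j \<and> r n j \<le> q (Suc (\<phi> n)) j + 1) sequentially"
      using ev_good by eventually_elim (simp add: good_def)
    note r = coord[OF this, THEN conjunct1] coord[OF this, THEN conjunct2]
    have "eventually (\<lambda>n. \<forall>j<Suc (\<phi> n). q (Suc (\<phi> n)) j \<le> s n j \<and> s n j \<le> q (Suc (\<phi> n)) j + 1) sequentially"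
      using ev_good by eventually_elim (simp add: good_def)
    note s = coord[OF this, THEN conjunct1] coord[OF this, THEN conjunct2]
    \<comment> \<open>The corners \<open>r\<close> carry one inequality between \<open>f\<close> and
      the identity, the corners \<open>s\<close> the other. Both sequences tend to \<open>x\<close>,
      so both inequalities survive in the limit.\<close>
    have "x i \<le> f x i"
      by (rule tendsto_le[OF sequentially_bot r(1) r(2)]) (use ev_good in eventually_elim, simp add: good_def)
    moreover have "f x i \<le> x i"
      by (rule tendsto_le[OF sequentially_bot s(2) s(1)]) (use ev_good in eventually_elim, simp add: good_def)
    ultimately show ?thesis by simp
  qed
  with x show ?thesis by (intro that) auto
qed

text \<open>Transport along \<open>to_nat\<close>: since \<open>from_nat (to_nat i) = i\<close>,
  composing a fixed point of the transported map with \<open>to_nat\<close> gives one of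
  \<open>f\<close>.\<close>

lemma hilbert_cube_fixed_point:
  fixes f :: "('a::countable \<Rightarrow> real) \<Rightarrow> 'a \<Rightarrow> real"
  assumes cont: "continuous_on unit_cube f"
    and into: "\<And>x. x \<in> unit_cube \<Longrightarrow> f x \<in> unit_cube"
  obtains x where "x \<in> unit_cube" "f x = x"
proof -
  have cube: "(\<lambda>i::'a. y (to_nat i)) \<in> unit_cube" if "y \<in> unit_cube" for y
    using that by (auto simp: unit_cube_def)
  have "continuous_on unit_cube (\<lambda>y n. f (\<lambda>i. y (to_nat i)) (from_nat n))"
    by (intro continuous_on_coordinatewise_then_product
          continuous_on_product_then_coordinatewise[OF continuous_on_compose2[OF cont]])
       (auto simp: cube continuous_on_product_coordinates[THEN continuous_on_subset[OF _ subset_UNIV]])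
  moreover have "(\<lambda>n. f (\<lambda>i. y (to_nat i)) (from_nat n)) \<in> unit_cube" if "y \<in> unit_cube" for y
    using into[OF cube[OF that]] by (auto simp: unit_cube_def)
  ultimately obtain y where y: "y \<in> unit_cube" "(\<lambda>n. f (\<lambda>i. y (to_nat i)) (from_nat n)) = y"
    by (rule hilbert_cube_fixed_point_nat)
  have "f (\<lambda>i. y (to_nat i)) = (\<lambda>i. y (to_nat i))"
  proof
    fix i show "f (\<lambda>i. y (to_nat i)) i = y (to_nat i)"
      using fun_cong[OF y(2), of "to_nat i"] by simp
  qed
  with cube[OF y(1)] show ?thesis by (rule that)
qed

section \<open>Nash's improvement map\<close>

text \<open>A continuous retraction of the cube onto distributions on \<open>A\<close>: missing mass
  is spread uniformly, excess mass is scaled away. It lets free cube coordinates encode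
  distributions, so that a fixed-point theorem for cubes suffices.\<close>

definition simplex_retract :: "'a set \<Rightarrow> ('a \<Rightarrow> real) \<Rightarrow> 'a \<Rightarrow> real" where
  "simplex_retract A y a =
     (if a \<in> A then (y a + max 0 (1 - sum y A) / card A) / max 1 (sum y A) else 0)"

lemma simplex_retract_nonneg: "y \<in> unit_cube \<Longrightarrow> 0 \<le> simplex_retract A y a"
  by (auto simp: simplex_retract_def unit_cube_def intro!: divide_nonneg_nonneg add_nonneg_nonneg)

lemma simplex_retract_outside [simp]: "a \<notin> A \<Longrightarrow> simplex_retract A y a = 0"
  by (simp add: simplex_retract_def)

lemma sum_simplex_retract:
  assumes "finite A" "A \<noteq> {}"
  shows "sum (simplex_retract A y) A = 1"
proof -
  have "sum (simplex_retract A y) A = (sum y A + max 0 (1 - sum y A)) / max 1 (sum y A)"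
    using assms by (simp add: simplex_retract_def sum.distrib flip: sum_divide_distrib)
  also have "\<dots> = 1" by (auto simp: max_def)
  finally show ?thesis .
qed

lemma simplex_retract_eq: "sum y A = 1 \<Longrightarrow> a \<in> A \<Longrightarrow> simplex_retract A y a = y a"
  by (simp add: simplex_retract_def)

lemma continuous_on_simplex_retract [continuous_intros]:
  assumes "\<And>a. continuous_on S (\<lambda>z. y z a)"
  shows "continuous_on S (\<lambda>z. simplex_retract A (y z) a)"
  unfolding simplex_retract_def by (cases "a \<in> A"; cases "card A = 0") (auto intro!: continuous_intros assms)

text \<open>If the gains of the improvement map leave \<open>\<psi>\<close> unchanged, then all gains vanish: some
  action in the support of \<open>\<psi>\<close> is no better than the average, hence has gain \<open>0\<close>.\<close>

lemma nash_improvement_fixed_point: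
  fixes \<psi> c :: "'a \<Rightarrow> real"
  assumes A: "finite A" and nonneg: "\<And>a. a \<in> A \<Longrightarrow> 0 \<le> \<psi> a" and one: "sum \<psi> A = 1"
    and fixed: "\<And>a. a \<in> A \<Longrightarrow>
      (\<psi> a + max 0 (c a - (\<Sum>b\<in>A. \<psi> b * c b))) / (1 + (\<Sum>d\<in>A. max 0 (c d - (\<Sum>b\<in>A. \<psi> b * c b)))) = \<psi> a"
    and a: "a \<in> A"
  shows "c a \<le> (\<Sum>b\<in>A. \<psi> b * c b)"
proof -
  define m where "m = (\<Sum>b\<in>A. \<psi> b * c b)"
  define G where "G = (\<Sum>d\<in>A. max 0 (c d - m))"
  have G: "0 \<le> G" unfolding G_def by (intro sum_nonneg) auto
  have eq: "max 0 (c b - m) = \<psi> b * G" if "b \<in> A" for b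
    using fixed[OF that] G unfolding m_def[symmetric] G_def[symmetric] by (simp add: field_simps)
  have "G = 0"
  proof (rule ccontr)
    assume "G \<noteq> 0"
    \<comment> \<open>If \<open>G\<close> were positive, every action in the support would have a
      positive gain, so the maximum with 0 could be dropped there. As the deviations from the mean
      average to 0, this makes the sum of the squares of \<open>\<psi>\<close> vanish.\<close>
    have "\<psi> b * (c b - m) = \<psi> b * (\<psi> b * G)" if "b \<in> A" for b
    proof (cases "\<psi> b = 0")
      case False
      then have "0 < \<psi> b * G" using nonneg[OF that] G \<open>G \<noteq> 0\<close> by simp
      then show ?thesis using eq[OF that] by (auto simp: max_def split: if_splits)
    qed simp
    then have "(\<Sum>b\<in>A. \<psi> b * (c b - m)) = (\<Sum>b\<in>A. \<psi> b * (\<psi> b * G))"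
      by (rule sum.cong[OF refl])
    also have "\<dots> = (\<Sum>b\<in>A. \<psi> b * \<psi> b) * G"
      by (simp add: sum_distrib_right mult.assoc)
    finally have "(\<Sum>b\<in>A. \<psi> b * (c b - m)) = (\<Sum>b\<in>A. \<psi> b * \<psi> b) * G" .
    moreover have "(\<Sum>b\<in>A. \<psi> b * (c b - m)) = m - sum \<psi> A * m"
      by (simp add: m_def[symmetric] right_diff_distrib sum_subtractf flip: sum_distrib_right)
    ultimately have "(\<Sum>b\<in>A. \<psi> b * \<psi> b) = 0"
      using one \<open>G \<noteq> 0\<close> by simp
    then have "\<forall>b\<in>A. \<psi> b = 0"
      by (subst (asm) sum_nonneg_eq_0_iff) (auto simp: A)
    then show False using one by simp
  qed
  with eq[OF a] show ?thesis by (simp add: m_def max_def split: if_splits)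
qed

definition mixed :: "'k set \<Rightarrow> ('k \<Rightarrow> 'a set) \<Rightarrow> ('k \<Rightarrow> 'a \<Rightarrow> real) \<Rightarrow> bool" where
  "mixed K A \<psi> \<longleftrightarrow> (\<forall>k a. 0 \<le> \<psi> k a) \<and> (\<forall>k a. a \<notin> A k \<longrightarrow> \<psi> k a = 0) \<and> (\<forall>k\<in>K. sum (\<psi> k) (A k) = 1)"

text \<open>Nash's map on the strategies and \<open>g\<close> on the parameters are run side by side
  as one self-map of a cube indexed by a sum type. A single fixed point then delivers the
  equilibrium and the parameter equations simultaneously, although each refers to the other.\<close>

lemma nash_with_parameters:
  fixes c :: "('k::countable \<Rightarrow> 'a::countable \<Rightarrow> real) \<Rightarrow> ('b::countable \<Rightarrow> real) \<Rightarrow> 'k \<Rightarrow> 'a \<Rightarrow> real"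
    and g :: "('k \<Rightarrow> 'a \<Rightarrow> real) \<Rightarrow> ('b \<Rightarrow> real) \<Rightarrow> 'b \<Rightarrow> real"
  assumes A: "\<And>k. k \<in> K \<Longrightarrow> finite (A k) \<and> A k \<noteq> {}"
    and c: "\<And>k a. k \<in> K \<Longrightarrow> a \<in> A k \<Longrightarrow> continuous_on UNIV (\<lambda>z. c (fst z) (snd z) k a)"
    and g: "\<And>b. continuous_on UNIV (\<lambda>z. g (fst z) (snd z) b)"
    and g_cube: "\<And>\<psi> y. mixed K A \<psi> \<Longrightarrow> y \<in> unit_cube \<Longrightarrow> g \<psi> y \<in> unit_cube"
  obtains \<psi> y where "mixed K A \<psi>" "y \<in> unit_cube" "g \<psi> y = y"
    "\<And>k a. k \<in> K \<Longrightarrow> a \<in> A k \<Longrightarrow> c \<psi> y k a \<le> (\<Sum>b\<in>A k. \<psi> k b * c \<psi> y k b)"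
proof -
  \<comment> \<open>Strategies are read off the \<open>Inl\<close> coordinates through the
    retraction, parameters directly off the \<open>Inr\<close> coordinates.\<close>
  define \<psi> where "\<psi> z = (\<lambda>k. simplex_retract (A k) (\<lambda>a. z (Inl (k, a))))" for z :: "('k \<times> 'a) + 'b \<Rightarrow> real"
  define y where "y z = (\<lambda>b. z (Inr b))" for z :: "('k \<times> 'a) + 'b \<Rightarrow> real"
  define m where "m z k = (\<Sum>b\<in>A k. \<psi> z k b * c (\<psi> z) (y z) k b)" for z k
  define gain where "gain z k a = max 0 (c (\<psi> z) (y z) k a - m z k)" for z k a
  define F where "F z = case_sum
      (\<lambda>(k, a). if k \<in> K \<and> a \<in> A k then (\<psi> z k a + gain z k a) / (1 + (\<Sum>b\<in>A k. gain z k b)) else 0)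
      (\<lambda>b. g (\<psi> z) (y z) b)" for z
  have mixed: "mixed K A (\<psi> z)" if "z \<in> unit_cube" for z
    using that A unfolding mixed_def \<psi>_def
    by (auto intro!: simplex_retract_nonneg sum_simplex_retract simp: unit_cube_def)
  have y_cube: "y z \<in> unit_cube" if "z \<in> unit_cube" for z
    using that by (auto simp: y_def unit_cube_def)
  have gain: "0 \<le> gain z k a" for z k a by (simp add: gain_def)
  have coord: "continuous_on UNIV (\<lambda>z :: ('k \<times> 'a) + 'b \<Rightarrow> real. z i)" for i
    by simp
  have pair: "continuous_on UNIV (\<lambda>z. (\<psi> z, y z))"
    unfolding \<psi>_def y_def
    by (intro continuous_on_Pair continuous_on_coordinatewise_then_product continuous_on_simplex_retract coord)
  have cont_c: "continuous_on UNIV (\<lambda>z. c (\<psi> z) (y z) k a)" if "k \<in> K" "a \<in> A k" for k a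
    using continuous_on_compose2[OF c[OF that] pair] by simp
  have cont_\<psi>: "continuous_on UNIV (\<lambda>z. \<psi> z k a)" for k a
    unfolding \<psi>_def by (intro continuous_on_simplex_retract coord)
  have cont_gain: "continuous_on UNIV (\<lambda>z. gain z k a)" if "k \<in> K" "a \<in> A k" for k a
    unfolding gain_def m_def using that by (intro continuous_intros cont_c cont_\<psi>)
  have "continuous_on UNIV F"
  proof (rule continuous_on_coordinatewise_then_product)
    fix i
    show "continuous_on UNIV (\<lambda>z. F z i)"
    proof (cases i)
      case (Inl ka)
      obtain k a where ka: "ka = (k, a)" by fastforce
      have "1 + (\<Sum>b\<in>A k. gain z k b) \<noteq> 0" for z
        using sum_nonneg[of "A k" "gain z k", OF gain] by linarith
      then show ?thesis unfolding Inl ka F_def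
        by (cases "k \<in> K \<and> a \<in> A k") (auto intro!: continuous_intros cont_gain cont_\<psi>)
    next
      case (Inr b)
      then show ?thesis
        using continuous_on_compose2[OF g pair] by (simp add: F_def)
    qed
  qed
  then have "continuous_on unit_cube F" by (rule continuous_on_subset) simp
  moreover have "F z \<in> unit_cube" if z: "z \<in> unit_cube" for z
  proof -
    have "0 \<le> F z i \<and> F z i \<le> 1" for i
    proof (cases i)
      case (Inl ka)
      obtain k a where ka: "ka = (k, a)" by fastforce
      show ?thesis
      proof (cases "k \<in> K \<and> a \<in> A k")
        case True
        have "\<psi> z k a \<le> 1"
          using mixed[OF z] A[of k] True member_le_sum[of a "A k" "\<psi> z k"] by (auto simp: mixed_def)
        moreover have "gain z k a \<le> (\<Sum>b\<in>A k. gain z k b)"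
          using A[of k] True gain by (intro member_le_sum) auto
        moreover have "0 \<le> \<psi> z k a" using mixed[OF z] by (simp add: mixed_def)
        ultimately show ?thesis using True gain[of z k a] unfolding Inl ka F_def
          by (auto simp: divide_le_eq_1)
      next
        case False
        then show ?thesis unfolding Inl ka F_def by auto
      qed
    next
      case (Inr b)
      then show ?thesis using g_cube[OF mixed[OF z] y_cube[OF z]] by (simp add: F_def unit_cube_def)
    qed
    then show ?thesis by (simp add: unit_cube_def)
  qed
  ultimately obtain z where z: "z \<in> unit_cube" "F z = z"
    by (rule hilbert_cube_fixed_point)
  note mix = mixed[OF z(1), unfolded mixed_def]
  show ?thesis
  proof (rule that[OF mixed[OF z(1)] y_cube[OF z(1)]])
    show "g (\<psi> z) (y z) = y z"
      using fun_cong[OF z(2), of "Inr _"] by (auto simp: F_def y_def)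
    fix k a assume k: "k \<in> K" and a: "a \<in> A k"
    have zF: "z (Inl (k, b)) = (\<psi> z k b + gain z k b) / (1 + (\<Sum>b\<in>A k. gain z k b))" if "b \<in> A k" for b
      using fun_cong[OF z(2), of "Inl (k, b)"] k that by (simp add: F_def)
    have pos: "1 + (\<Sum>b\<in>A k. gain z k b) \<noteq> 0"
      using sum_nonneg[of "A k" "gain z k", OF gain] by linarith
    \<comment> \<open>Nash's map produces mass one, so the raw coordinates of a fixed point already
      form a distribution. The retraction therefore leaves them unchanged, and the fixed point of
      \<open>F\<close> is one of Nash's map itself.\<close>
    have "(\<Sum>b\<in>A k. z (Inl (k, b))) = (\<Sum>b\<in>A k. (\<psi> z k b + gain z k b) / (1 + (\<Sum>b\<in>A k. gain z k b)))"
      using zF by (intro sum.cong) auto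
    also have "\<dots> = (sum (\<psi> z k) (A k) + (\<Sum>b\<in>A k. gain z k b)) / (1 + (\<Sum>b\<in>A k. gain z k b))"
      by (simp add: sum.distrib flip: sum_divide_distrib)
    also have "\<dots> = 1" using mix k pos by simp
    finally have "\<psi> z k b = z (Inl (k, b))" if "b \<in> A k" for b
      using that by (simp add: \<psi>_def simplex_retract_eq)
    then have fixed: "(\<psi> z k b + gain z k b) / (1 + (\<Sum>b\<in>A k. gain z k b)) = \<psi> z k b" if "b \<in> A k" for b
      using zF that by simp
    show "c (\<psi> z) (y z) k a \<le> (\<Sum>b\<in>A k. \<psi> z k b * c (\<psi> z) (y z) k b)"
      by (rule nash_improvement_fixed_point[OF _ _ _ _ a])
         (use A mix k fixed in \<open>auto simp: gain_def m_def\<close>)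
  qed
qed

section \<open>Stationary equilibria\<close>

lemma abs_convex_sum_le:
  fixes p x :: "'a \<Rightarrow> real"
  assumes "\<And>a. a \<in> A \<Longrightarrow> 0 \<le> p a" "\<And>a. a \<in> A \<Longrightarrow> \<bar>x a\<bar> \<le> B"
  shows "\<bar>\<Sum>a\<in>A. p a * x a\<bar> \<le> sum p A * B"
proof -
  have "\<bar>\<Sum>a\<in>A. p a * x a\<bar> \<le> (\<Sum>a\<in>A. \<bar>p a * x a\<bar>)" by (rule sum_abs)
  also have "\<dots> \<le> (\<Sum>a\<in>A. p a * B)"
    using assms by (intro sum_mono) (auto simp: abs_mult intro!: mult_left_mono)
  finally show ?thesis by (simp add: sum_distrib_right)
qed

text \<open>The rewards are evaluated at the long-run state-action laws, products of
  \<open>\<rho>\<close> and \<open>\<psi>\<close>, so they couple the players. Taking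
  \<open>\<rho>\<close> and \<open>h\<close> as the parameters and the pairs of a player and a state
  as the decision makers settles all players by one fixed point.\<close>

lemma stationary_equilibrium:
  fixes S :: "'i::countable \<Rightarrow> 's::countable set"
    and A :: "'i \<Rightarrow> 's \<Rightarrow> 'a::countable set"
    and P :: "'i \<Rightarrow> 's \<Rightarrow> 'a \<Rightarrow> 's \<Rightarrow> real"
    and r :: "('i \<Rightarrow> 's \<Rightarrow> 'a \<Rightarrow> real) \<Rightarrow> 'i \<Rightarrow> 's \<Rightarrow> 'a \<Rightarrow> real"
    and lam M :: "'i \<Rightarrow> real"
  assumes S: "\<And>i. i \<in> I \<Longrightarrow> finite (S i) \<and> S i \<noteq> {}"
    and A: "\<And>i s. i \<in> I \<Longrightarrow> s \<in> S i \<Longrightarrow> finite (A i s) \<and> A i s \<noteq> {}"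
    and lam: "\<And>i. i \<in> I \<Longrightarrow> 0 < lam i"
    and P_ge: "\<And>i s a s'. i \<in> I \<Longrightarrow> s \<in> S i \<Longrightarrow> a \<in> A i s \<Longrightarrow> s' \<in> S i \<Longrightarrow> lam i \<le> P i s a s'"
    and P_sum: "\<And>i s a. i \<in> I \<Longrightarrow> s \<in> S i \<Longrightarrow> a \<in> A i s \<Longrightarrow> (\<Sum>s'\<in>S i. P i s a s') = 1"
    and r_cont: "\<And>i s a. i \<in> I \<Longrightarrow> s \<in> S i \<Longrightarrow> a \<in> A i s \<Longrightarrow> continuous_on UNIV (\<lambda>\<omega>. r \<omega> i s a)"
    and r_bound: "\<And>\<omega> i s a. i \<in> I \<Longrightarrow> s \<in> S i \<Longrightarrow> a \<in> A i s \<Longrightarrow> \<bar>r \<omega> i s a\<bar> \<le> M i"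
  obtains \<psi> :: "'i \<Rightarrow> 's \<Rightarrow> 'a \<Rightarrow> real" and \<rho> h :: "'i \<Rightarrow> 's \<Rightarrow> real" and \<gamma> :: "'i \<Rightarrow> real"
  where "\<And>i s a. 0 \<le> \<psi> i s a" "\<And>i s a. a \<notin> A i s \<Longrightarrow> \<psi> i s a = 0"
    "\<And>i s. i \<in> I \<Longrightarrow> s \<in> S i \<Longrightarrow> (\<Sum>a\<in>A i s. \<psi> i s a) = 1"
    "\<And>i s. 0 \<le> \<rho> i s" "\<And>i. i \<in> I \<Longrightarrow> (\<Sum>s\<in>S i. \<rho> i s) = 1"
    "\<And>i s'. i \<in> I \<Longrightarrow> s' \<in> S i \<Longrightarrow> \<rho> i s' = (\<Sum>s\<in>S i. \<rho> i s * (\<Sum>a\<in>A i s. \<psi> i s a * P i s a s'))"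
    "\<And>i s a. i \<in> I \<Longrightarrow> s \<in> S i \<Longrightarrow> a \<in> A i s \<Longrightarrow>
       r (\<lambda>i s a. \<rho> i s * \<psi> i s a) i s a + (\<Sum>s'\<in>S i. P i s a s' * h i s') \<le> \<gamma> i + h i s"
    "\<And>i s. i \<in> I \<Longrightarrow> s \<in> S i \<Longrightarrow>
       (\<Sum>a\<in>A i s. \<psi> i s a * (r (\<lambda>i s a. \<rho> i s * \<psi> i s a) i s a + (\<Sum>s'\<in>S i. P i s a s' * h i s')))
       = \<gamma> i + h i s"
proof -
  define K where "K = {(i, s). i \<in> I \<and> s \<in> S i}"
  define A' where "A' = (\<lambda>(i, s). A i s)"
  \<comment> \<open>the solution of \<open>\<bar>M\<bar> + 1 + (1 - lam * card S) * C = C\<close>, so that relative values stay in \<open>[-C, C]\<close>\<close>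
  define C where "C i = (\<bar>M i\<bar> + 1) / (lam i * card (S i))" for i
  \<comment> \<open>Parameters tagged \<open>True\<close> encode relative values, stretched affinely
    from \<open>[0, 1]\<close> to \<open>[-C, C]\<close>; those tagged \<open>False\<close> encode
    stationary laws.\<close>
  define H where "H y i s = C i * (2 * y (True, i, s) - 1)" for y :: "bool \<times> 'i \<times> 's \<Rightarrow> real" and i s
  define R where "R y i = simplex_retract (S i) (\<lambda>s. y (False, i, s))" for y :: "bool \<times> 'i \<times> 's \<Rightarrow> real" and i
  define \<omega> where "\<omega> \<psi> y = (\<lambda>i s a. R y i s * \<psi> (i, s) a)" for \<psi> :: "'i \<times> 's \<Rightarrow> 'a \<Rightarrow> real" and y
  \<comment> \<open>The value of playing \<open>a\<close> now and collecting \<open>H\<close>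
    afterwards, under the kernel \<open>P - lam\<close> of total mass
    \<open>1 - lam * card S\<close>.\<close>
  define c where "c \<psi> y = (\<lambda>(i, s) a. r (\<omega> \<psi> y) i s a + (\<Sum>s'\<in>S i. (P i s a s' - lam i) * H y i s'))" for \<psi> y
  \<comment> \<open>The \<open>True\<close> part is policy evaluation, mapped back to
    \<open>[0, 1]\<close> by the inverse of the stretching in \<open>H\<close>. The
    \<open>False\<close> part is one step of the chain under \<open>\<psi>\<close>.\<close>
  define g where "g \<psi> y = (\<lambda>(b, i, s). if i \<in> I \<and> s \<in> S i then
      (if b then ((\<Sum>a\<in>A i s. \<psi> (i, s) a * c \<psi> y (i, s) a) / C i + 1) / 2
       else \<Sum>s0\<in>S i. R y i s0 * (\<Sum>a\<in>A i s0. \<psi> (i, s0) a * P i s0 a s)) else 0)" for \<psi> y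
  have card_S: "0 < card (S i)" if "i \<in> I" for i
    using S[OF that] by (simp add: card_gt_0_iff)
  \<comment> \<open>The summand 1 in \<open>C\<close> keeps it positive even for
    \<open>M i = 0\<close>, so that the stretching in \<open>H\<close> can be inverted.\<close>
  have C: "0 < C i" if "i \<in> I" for i
    using lam[OF that] card_S[OF that] unfolding C_def by (intro divide_pos_pos mult_pos_pos) auto
  have coord: "continuous_on UNIV (\<lambda>z::('i \<times> 's \<Rightarrow> 'a \<Rightarrow> real) \<times> (bool \<times> 'i \<times> 's \<Rightarrow> real). snd z b)"
    "continuous_on UNIV (\<lambda>z::('i \<times> 's \<Rightarrow> 'a \<Rightarrow> real) \<times> (bool \<times> 'i \<times> 's \<Rightarrow> real). fst z k a)" for b k a
    by (rule continuous_on_product_then_coordinatewise[OF continuous_on_snd[OF continuous_on_id]]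
        continuous_on_product_then_coordinatewise[OF
          continuous_on_product_then_coordinatewise[OF continuous_on_fst[OF continuous_on_id]]])+
  have cont_H: "continuous_on UNIV (\<lambda>z::('i \<times> 's \<Rightarrow> 'a \<Rightarrow> real) \<times> (bool \<times> 'i \<times> 's \<Rightarrow> real). H (snd z) i s)" for i s
    unfolding H_def by (intro continuous_intros coord)
  have cont_R: "continuous_on UNIV (\<lambda>z::('i \<times> 's \<Rightarrow> 'a \<Rightarrow> real) \<times> (bool \<times> 'i \<times> 's \<Rightarrow> real). R (snd z) i s)" for i s
    unfolding R_def by (intro continuous_on_simplex_retract coord)
  have cont_\<omega>: "continuous_on UNIV (\<lambda>z. \<omega> (fst z) (snd z))"
    unfolding \<omega>_def by (intro continuous_on_coordinatewise_then_product continuous_on_mult cont_R coord)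
  have cont_c: "continuous_on UNIV (\<lambda>z. c (fst z) (snd z) (i, s) a)" if "i \<in> I" "s \<in> S i" "a \<in> A i s" for i s a
    unfolding c_def prod.case
    by (intro continuous_on_add continuous_on_sum continuous_on_mult continuous_on_const cont_H
        continuous_on_compose2[OF r_cont[OF that] cont_\<omega>]) auto
  have cont_g: "continuous_on UNIV (\<lambda>z. g (fst z) (snd z) b)" for b
  proof -
    obtain b1 i s where b: "b = (b1, i, s)" by (cases b)
    show ?thesis
    proof (cases "i \<in> I \<and> s \<in> S i")
      case True
      show ?thesis
      proof (cases b1)
        case b1: True
        have "continuous_on UNIV (\<lambda>z. ((\<Sum>a\<in>A i s. fst z (i, s) a * c (fst z) (snd z) (i, s) a) / C i + 1) / 2)"
          using True C[of i]
          by (intro continuous_on_divide continuous_on_add continuous_on_sum continuous_on_mult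
              continuous_on_const cont_c coord) auto
        then show ?thesis using True b1 by (simp add: g_def b)
      next
        case b1: False
        have "continuous_on UNIV (\<lambda>z::('i \<times> 's \<Rightarrow> 'a \<Rightarrow> real) \<times> (bool \<times> 'i \<times> 's \<Rightarrow> real).
            \<Sum>s0\<in>S i. R (snd z) i s0 * (\<Sum>a\<in>A i s0. fst z (i, s0) a * P i s0 a s))"
          by (intro continuous_on_sum continuous_on_mult continuous_on_const cont_R coord)
        then show ?thesis using True b1 by (simp add: g_def b)
      qed
    next
      case False
      then show ?thesis by (auto simp: g_def b)
    qed
  qed
  have P_nonneg: "0 \<le> P i s a s'" if "i \<in> I" "s \<in> S i" "a \<in> A i s" "s' \<in> S i" for i s a s'
    using P_ge[OF that] lam[OF that(1)] by linarith
  have R_nonneg: "0 \<le> R y i s" if "y \<in> unit_cube" for y i s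
    using that unfolding R_def by (intro simplex_retract_nonneg) (auto simp: unit_cube_def)
  have R_sum: "sum (R y i) (S i) = 1" if "i \<in> I" for y i
    using S[OF that] unfolding R_def by (intro sum_simplex_retract) auto
  have H_bound: "\<bar>H y i s\<bar> \<le> C i" if "y \<in> unit_cube" "i \<in> I" for y i s
  proof -
    have "\<bar>2 * y (True, i, s) - 1\<bar> \<le> 1" using that by (auto simp: unit_cube_def abs_le_iff)
    then show ?thesis unfolding H_def abs_mult using C[OF that(2)] by (simp add: mult_left_le)
  qed
  have c_bound: "\<bar>c \<psi> y (i, s) a\<bar> \<le> C i" if y: "y \<in> unit_cube" and i: "i \<in> I" "s \<in> S i" "a \<in> A i s" for \<psi> y i s a
  proof -
    have "\<bar>\<Sum>s'\<in>S i. (P i s a s' - lam i) * H y i s'\<bar> \<le> (\<Sum>s'\<in>S i. P i s a s' - lam i) * C i"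
      using P_ge[OF i] H_bound[OF y i(1)] by (intro abs_convex_sum_le) auto
    also have "\<dots> = (1 - lam i * card (S i)) * C i"
      by (simp add: sum_subtractf P_sum[OF i])
    also have "\<dots> = C i - (\<bar>M i\<bar> + 1)"
      using lam[OF i(1)] card_S[OF i(1)] by (simp add: C_def field_simps)
    finally show ?thesis using r_bound[OF i, of "\<omega> \<psi> y"] unfolding c_def by simp
  qed
  have mixed_sum: "sum (\<psi> (i, s)) (A i s) = 1" "0 \<le> \<psi> (i, s) a"
    if "mixed K A' \<psi>" "i \<in> I" "s \<in> S i" for \<psi> :: "'i \<times> 's \<Rightarrow> 'a \<Rightarrow> real" and i s a
    using that by (auto simp: mixed_def K_def A'_def)
  have stat_nonneg: "0 \<le> (\<Sum>s0\<in>S i. R y i s0 * (\<Sum>a\<in>A i s0. \<psi> (i, s0) a * P i s0 a s))"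
    if "mixed K A' \<psi>" "y \<in> unit_cube" "i \<in> I" "s \<in> S i" for \<psi> y i s
    using that by (intro sum_nonneg mult_nonneg_nonneg R_nonneg P_nonneg mixed_sum(2)) auto
  have stat_sum: "(\<Sum>s\<in>S i. \<Sum>s0\<in>S i. R y i s0 * (\<Sum>a\<in>A i s0. \<psi> (i, s0) a * P i s0 a s)) = 1"
    if "mixed K A' \<psi>" "i \<in> I" for \<psi> y i
  proof -
    have "(\<Sum>s\<in>S i. \<Sum>s0\<in>S i. R y i s0 * (\<Sum>a\<in>A i s0. \<psi> (i, s0) a * P i s0 a s))
        = (\<Sum>s0\<in>S i. R y i s0 * (\<Sum>a\<in>A i s0. \<psi> (i, s0) a * (\<Sum>s\<in>S i. P i s0 a s)))"
    proof (subst sum.swap, intro sum.cong refl)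
      fix s0
      show "(\<Sum>s\<in>S i. R y i s0 * (\<Sum>a\<in>A i s0. \<psi> (i, s0) a * P i s0 a s))
          = R y i s0 * (\<Sum>a\<in>A i s0. \<psi> (i, s0) a * (\<Sum>s\<in>S i. P i s0 a s))"
        unfolding sum_distrib_left by (rule sum.swap)
    qed
    also have "\<dots> = (\<Sum>s0\<in>S i. R y i s0 * (\<Sum>a\<in>A i s0. \<psi> (i, s0) a))"
      using P_sum that(2) by simp
    also have "\<dots> = 1" using mixed_sum(1)[OF that] R_sum[OF that(2)] by simp
    finally show ?thesis .
  qed
  have g_cube: "g \<psi> y \<in> unit_cube" if \<psi>: "mixed K A' \<psi>" and y: "y \<in> unit_cube" for \<psi> y
  proof -
    have "0 \<le> g \<psi> y (b, i, s) \<and> g \<psi> y (b, i, s) \<le> 1" for b i s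
    proof (cases "i \<in> I \<and> s \<in> S i")
      case True
      then have is': "i \<in> I" "s \<in> S i" by auto
      show ?thesis
      proof (cases b)
        case b: True
        have "\<bar>\<Sum>a\<in>A i s. \<psi> (i, s) a * c \<psi> y (i, s) a\<bar> \<le> sum (\<psi> (i, s)) (A i s) * C i"
          using mixed_sum(2)[OF \<psi> is'] c_bound[OF y is'] by (intro abs_convex_sum_le) auto
        then have "\<bar>(\<Sum>a\<in>A i s. \<psi> (i, s) a * c \<psi> y (i, s) a) / C i\<bar> \<le> 1"
          using C[OF is'(1)] mixed_sum(1)[OF \<psi> is'] by (simp add: abs_divide)
        then have "(\<Sum>a\<in>A i s. \<psi> (i, s) a * c \<psi> y (i, s) a) / C i \<le> 1"
          "- ((\<Sum>a\<in>A i s. \<psi> (i, s) a * c \<psi> y (i, s) a) / C i) \<le> 1"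
          by (simp_all only: abs_le_iff)
        then show ?thesis using True b by (simp add: g_def)
      next
        case b: False
        have "(\<Sum>s0\<in>S i. R y i s0 * (\<Sum>a\<in>A i s0. \<psi> (i, s0) a * P i s0 a s)) \<le>
            (\<Sum>s\<in>S i. \<Sum>s0\<in>S i. R y i s0 * (\<Sum>a\<in>A i s0. \<psi> (i, s0) a * P i s0 a s))"
          using S[OF is'(1)] is' stat_nonneg[OF \<psi> y is'(1)]
          by (intro member_le_sum[where f = "\<lambda>s. \<Sum>s0\<in>S i. R y i s0 * (\<Sum>a\<in>A i s0. \<psi> (i, s0) a * P i s0 a s)"]) auto
        then show ?thesis using True b stat_nonneg[OF \<psi> y is'] stat_sum[OF \<psi> is'(1)] by (simp add: g_def)
      qed
    next
      case False
      then show ?thesis unfolding g_def by auto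
    qed
    then show ?thesis by (auto simp: unit_cube_def)
  qed
  obtain \<psi> y where \<psi>: "mixed K A' \<psi>" and y: "y \<in> unit_cube" and gy: "g \<psi> y = y"
    and opt: "\<And>k a. k \<in> K \<Longrightarrow> a \<in> A' k \<Longrightarrow> c \<psi> y k a \<le> (\<Sum>b\<in>A' k. \<psi> k b * c \<psi> y k b)"
    by (rule nash_with_parameters[where K = K and A = A' and c = c and g = g])
       (use A cont_c cont_g g_cube in \<open>auto simp: K_def A'_def\<close>)
  \<comment> \<open>The average against which Nash's condition compares each action is thus the
    relative value itself, which turns that condition into an optimality inequality.\<close>
  have H_eq: "H y i s = (\<Sum>a\<in>A i s. \<psi> (i, s) a * c \<psi> y (i, s) a)" if "i \<in> I" "s \<in> S i" for i s
    using fun_cong[OF gy, of "(True, i, s)"] that C[OF that(1)] by (simp add: H_def g_def field_simps)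
  have y_eq: "y (False, i, s) = (\<Sum>s0\<in>S i. R y i s0 * (\<Sum>a\<in>A i s0. \<psi> (i, s0) a * P i s0 a s))"
    if "i \<in> I" "s \<in> S i" for i s
    using fun_cong[OF gy, of "(False, i, s)"] that by (simp add: g_def)
  \<comment> \<open>A step of the chain preserves mass, so the \<open>False\<close> coordinates at
    the fixed point sum to one and the retraction is idle on them.\<close>
  have R_eq: "R y i s = y (False, i, s)" if "i \<in> I" "s \<in> S i" for i s
    using stat_sum[OF \<psi> that(1), of y] that y_eq[OF that(1)] unfolding R_def
    by (intro simplex_retract_eq) (auto cong: sum.cong)
  \<comment> \<open>Restoring the subtracted mass splits off a term independent of state and action;
    this constant is the long-run average \<open>\<gamma>\<close>.\<close>
  have c_eq: "c \<psi> y (i, s) a = r (\<omega> \<psi> y) i s a + (\<Sum>s'\<in>S i. P i s a s' * H y i s') - lam i * sum (H y i) (S i)" for i s a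
    by (simp add: c_def algebra_simps sum_subtractf sum_distrib_left)
  show ?thesis
  proof (rule that[of "\<lambda>i s a. \<psi> (i, s) a" "R y" "H y" "\<lambda>i. lam i * sum (H y i) (S i)"])
    show "0 \<le> \<psi> (i, s) a" "a \<notin> A i s \<Longrightarrow> \<psi> (i, s) a = 0" for i s a
      using \<psi> by (auto simp: mixed_def A'_def)
    show "0 \<le> R y i s" for i s by (rule R_nonneg[OF y])
    fix i assume i: "i \<in> I"
    show "(\<Sum>s\<in>S i. R y i s) = 1" by (rule R_sum[OF i])
    fix s assume s: "s \<in> S i"
    show "(\<Sum>a\<in>A i s. \<psi> (i, s) a) = 1" by (rule mixed_sum[OF \<psi> i s])
    show "R y i s = (\<Sum>s0\<in>S i. R y i s0 * (\<Sum>a\<in>A i s0. \<psi> (i, s0) a * P i s0 a s))"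
      using R_eq[OF i s] y_eq[OF i s] by simp
    have "H y i s = (\<Sum>a\<in>A i s. \<psi> (i, s) a * (r (\<omega> \<psi> y) i s a + (\<Sum>s'\<in>S i. P i s a s' * H y i s')))
        - (\<Sum>a\<in>A i s. \<psi> (i, s) a) * (lam i * sum (H y i) (S i))"
      unfolding H_eq[OF i s] c_eq by (simp add: sum_distrib_right right_diff_distrib sum_subtractf)
    then show "(\<Sum>a\<in>A i s. \<psi> (i, s) a * (r (\<lambda>i s a. R y i s * \<psi> (i, s) a) i s a
         + (\<Sum>s'\<in>S i. P i s a s' * H y i s'))) = lam i * sum (H y i) (S i) + H y i s"
      using mixed_sum(1)[OF \<psi> i s] by (simp add: \<omega>_def)
    fix a assume a: "a \<in> A i s"
    have "c \<psi> y (i, s) a \<le> H y i s"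
      using opt[of "(i, s)" a] i s a by (simp add: K_def A'_def H_eq)
    then show "r (\<lambda>i s a. R y i s * \<psi> (i, s) a) i s a + (\<Sum>s'\<in>S i. P i s a s' * H y i s')
        \<le> lam i * sum (H y i) (S i) + H y i s"
      by (simp add: c_eq \<omega>_def)
  qed
qed

section \<open>Controlled dynamics of one prosumer\<close>

lemma average_tendsto_zero:
  fixes X :: "nat \<Rightarrow> real"
  assumes X: "X \<longlonglongrightarrow> 0"
  shows "(\<lambda>T. (1 / real T) * (\<Sum>t<T. X t)) \<longlonglongrightarrow> 0"
proof (rule LIMSEQ_I)
  fix e :: real assume e: "0 < e"
  then obtain n where n: "\<And>t. t \<ge> n \<Longrightarrow> \<bar>X t\<bar> < e / 2"
    using LIMSEQ_D[OF X, of "e / 2"] by auto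
  define B where "B = (\<Sum>t<n. \<bar>X t\<bar>)"
  have le: "\<bar>\<Sum>t<T. X t\<bar> \<le> B + real T * (e / 2)" for T
  proof -
    have "\<bar>\<Sum>t<T. X t\<bar> \<le> (\<Sum>t<T. \<bar>X t\<bar>)" by (rule sum_abs)
    also have "\<dots> \<le> (\<Sum>t<T. (if t < n then \<bar>X t\<bar> else 0) + e / 2)"
      using n e by (intro sum_mono) (force simp: not_less intro: less_imp_le)
    also have "\<dots> = (\<Sum>t\<in>{..<T} \<inter> {..<n}. \<bar>X t\<bar>) + real T * (e / 2)"
      by (simp add: sum.distrib sum.inter_restrict)
    also have "\<dots> \<le> B + real T * (e / 2)"
      unfolding B_def by (intro add_right_mono sum_mono2) auto
    finally show ?thesis .
  qed
  \<comment> \<open>Beyond \<open>m\<close> the head \<open>B\<close> contributes less than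
    \<open>e / 2\<close> to the average.\<close>
  obtain m :: nat where m: "2 * B / e < real m" using reals_Archimedean2 by blast
  have "norm ((1 / real T) * (\<Sum>t<T. X t) - 0) < e" if T: "T \<ge> Suc m" for T
  proof -
    have "2 * B / e < real T" using m T by linarith
    then have "B < real T * (e / 2)" using e by (simp add: field_simps)
    then have "\<bar>\<Sum>t<T. X t\<bar> < real T * e" using le[of T] by linarith
    then show ?thesis using T by (simp add: abs_mult field_simps)
  qed
  then show "\<exists>no. \<forall>T\<ge>no. norm ((1 / real T) * (\<Sum>t<T. X t) - 0) < e" by blast
qed

lemma pmf_with_finite_support:
  fixes f :: "'a \<Rightarrow> real"
  assumes "finite A" "\<And>a. 0 \<le> f a" "\<And>a. a \<notin> A \<Longrightarrow> f a = 0" "sum f A = 1"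
  obtains p where "pmf p = f"
proof -
  have "(\<integral>\<^sup>+ x. ennreal (f x) \<partial>count_space UNIV) = (\<Sum>a\<in>A. ennreal (f a))"
    using assms by (intro nn_integral_count_space'[of A]) auto
  also have "\<dots> = 1" using assms by (simp add: sum_ennreal)
  finally have "pmf (embed_pmf f) = f"
    using assms(2) by (intro ext pmf_embed_pmf) auto
  then show ?thesis by (rule that)
qed

lemma finite_feasible: "finite (feasible Smax Lmax Dmax s)"
  by (rule finite_subset[of _ "{..Lmax} \<times> {..Dmax}"]) (auto simp: feasible_def)

lemma feasible_nonempty: "s \<le> Smax \<Longrightarrow> feasible Smax Lmax Dmax s \<noteq> {}"
  by (rule ex_in_conv[THEN iffD1], rule exI[of _ "(0, 0)"]) (simp add: feasible_def)

lemma stationary_apply [simp]: "stationary \<Psi> (h, s) = \<Psi> s"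
  by (simp add: stationary_def)

lemma next_state_le: "next_state Smax s a g \<le> Smax"
  by (simp add: next_state_def)

text \<open>Every state is reachable in one step: feasibility puts \<open>s + d - l\<close> into the state space, so
  the required generation has modulus at most \<open>Smax\<close>.\<close>

lemma pmf_next_state_ge:
  assumes "\<And>k. \<bar>k\<bar> \<le> int Smax \<Longrightarrow> lam \<le> pmf G k"
    and "a \<in> feasible Smax Lmax Dmax s" "s' \<le> Smax"
  shows "lam \<le> pmf (map_pmf (next_state Smax s a) G) s'"
proof -
  define k where "k = int s' - (int s + int (snd a) - int (fst a))"
  have "\<bar>k\<bar> \<le> int Smax" "next_state Smax s a k = s'"
    using assms(2,3) by (auto simp: k_def feasible_def next_state_def)
  moreover have "pmf G k \<le> measure G (next_state Smax s a -` {s'})"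
    using \<open>next_state Smax s a k = s'\<close> unfolding pmf.rep_eq
    by (intro measure_pmf.finite_measure_mono) auto
  ultimately show ?thesis
    using assms(1)[of k] by (simp add: pmf_map)
qed

section \<open>State and state-action laws under a history-dependent policy\<close>

locale prosumer =
  fixes mu :: "nat pmf" and G :: "int pmf" and Smax Lmax Dmax :: nat
    and \<theta> :: "hist \<Rightarrow> (nat \<times> nat) pmf"
  assumes init: "set_pmf mu \<subseteq> {..Smax}"
    and valid: "valid_policy Smax Lmax Dmax \<theta>"
begin

text \<open>Time is shifted by one: this is the law of the state in period \<open>t + 1\<close>, and
  it belongs to \<open>sa_law\<close> at \<open>Suc t\<close>.\<close>

definition state_law :: "nat \<Rightarrow> nat pmf" where
  "state_law t = map_pmf snd (hist_law mu G Smax \<theta> t)"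

abbreviation trans :: "nat \<Rightarrow> nat \<times> nat \<Rightarrow> nat \<Rightarrow> real" where
  "trans s a s' \<equiv> pmf (map_pmf (next_state Smax s a) G) s'"

abbreviation pairs :: "(nat \<times> (nat \<times> nat)) set" where
  "pairs \<equiv> Sigma {..Smax} (feasible Smax Lmax Dmax)"

lemma finite_pairs: "finite pairs"
  by (simp add: finite_feasible)

text \<open>The history influences the next state only through the current state and action. Hence
  even for history-dependent policies the state-action laws alone drive the state laws.\<close>

lemma state_law_Suc:
  "state_law (Suc t) = bind_pmf (sa_law mu G Smax \<theta> (Suc t)) (\<lambda>(s, a). map_pmf (next_state Smax s a) G)"
  by (simp add: state_law_def sa_law_def map_bind_pmf bind_assoc_pmf bind_map_pmf map_pmf_comp
      case_prod_beta o_def)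

lemma map_fst_sa_law: "map_pmf fst (sa_law mu G Smax \<theta> (Suc t)) = state_law t"
  by (simp add: state_law_def sa_law_def map_bind_pmf map_pmf_comp case_prod_beta map_pmf_def[symmetric]
      bind_return_pmf')

lemma set_state_law: "set_pmf (state_law t) \<subseteq> {..Smax}"
proof (cases t)
  case 0
  then show ?thesis using init by (simp add: state_law_def map_pmf_comp)
next
  case (Suc t')
  then show ?thesis using next_state_le by (auto simp: state_law_Suc)
qed

lemma set_sa_law: "set_pmf (sa_law mu G Smax \<theta> (Suc t)) \<subseteq> pairs"
proof -
  have "s \<le> Smax" if "(h, s) \<in> set_pmf (hist_law mu G Smax \<theta> t)" for h s
    using set_state_law[of t] that by (force simp: state_law_def)
  then show ?thesis using valid by (fastforce simp: sa_law_def valid_policy_def)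
qed

lemma sa_prob_bounds: "0 \<le> sa_prob mu G Smax \<theta> t x" "sa_prob mu G Smax \<theta> t x \<le> 1"
  by (simp_all add: sa_prob_def pmf_le_1)

lemma sa_prob_outside: "x \<notin> pairs \<Longrightarrow> sa_prob mu G Smax \<theta> (Suc t) x = 0"
  using set_sa_law[of t] by (auto simp: sa_prob_def set_pmf_iff)

lemma sum_sa_prob: "(\<Sum>x\<in>pairs. sa_prob mu G Smax \<theta> (Suc t) x) = 1"
  unfolding sa_prob_def by (rule sum_pmf_eq_1[OF finite_pairs set_sa_law])

lemma sum_sa_prob_fst:
  "(\<Sum>x\<in>pairs. sa_prob mu G Smax \<theta> (Suc t) x * f (fst x)) = (\<Sum>s\<le>Smax. pmf (state_law t) s * f s)"
proof -
  have "(\<Sum>x\<in>pairs. sa_prob mu G Smax \<theta> (Suc t) x * f (fst x))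
      = (\<integral>x. f (fst x) \<partial>sa_law mu G Smax \<theta> (Suc t))"
    using set_sa_law
    by (subst integral_measure_pmf_real[OF finite_pairs]) (auto simp: sa_prob_def mult.commute)
  also have "\<dots> = (\<integral>s. f s \<partial>state_law t)"
    by (simp flip: map_fst_sa_law)
  also have "\<dots> = (\<Sum>s\<le>Smax. pmf (state_law t) s * f s)"
    using set_state_law by (subst integral_measure_pmf_real[of "{..Smax}"]) (auto simp: mult.commute)
  finally show ?thesis .
qed

lemma pmf_state_law_Suc:
  "pmf (state_law (Suc t)) s' = (\<Sum>x\<in>pairs. sa_prob mu G Smax \<theta> (Suc t) x * trans (fst x) (snd x) s')"
  unfolding state_law_Suc pmf_bind
  using set_sa_law
  by (subst integral_measure_pmf_real[OF finite_pairs]) (auto simp: sa_prob_def case_prod_beta mult.commute)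

lemma sum_pmf_state_law_Suc:
  "(\<Sum>s'\<le>Smax. pmf (state_law (Suc t)) s' * f s')
    = (\<Sum>x\<in>pairs. sa_prob mu G Smax \<theta> (Suc t) x * (\<Sum>s'\<le>Smax. trans (fst x) (snd x) s' * f s'))"
  unfolding pmf_state_law_Suc sum_distrib_right sum_distrib_left mult.assoc by (rule sum.swap)

lemma sum_state_law_bound:
  assumes "\<And>s. s \<le> Smax \<Longrightarrow> \<bar>f s\<bar> \<le> B"
  shows "\<bar>\<Sum>s\<le>Smax. pmf (state_law t) s * f s\<bar> \<le> B"
  using abs_convex_sum_le[of "{..Smax}" "pmf (state_law t)" f B] assms sum_pmf_eq_1[OF _ set_state_law]
  by simp

text \<open>Averaging the optimality inequality over the state-action law turns the expected next
  value into the mean of \<open>h\<close> under the next state law, so the means of \<open>h\<close>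
  telescope.\<close>

lemma sum_reward_le:
  assumes "\<And>s a. s \<le> Smax \<Longrightarrow> a \<in> feasible Smax Lmax Dmax s \<Longrightarrow>
      r s a + (\<Sum>s'\<le>Smax. trans s a s' * h s') \<le> \<gamma> + h s"
  shows "(\<Sum>t<T. \<Sum>x\<in>pairs. sa_prob mu G Smax \<theta> (Suc t) x * r (fst x) (snd x))
    \<le> real T * \<gamma> + (\<Sum>s\<le>Smax. pmf (state_law 0) s * h s) - (\<Sum>s\<le>Smax. pmf (state_law T) s * h s)"
proof (induction T)
  case (Suc T)
  have "(\<Sum>x\<in>pairs. sa_prob mu G Smax \<theta> (Suc T) x * r (fst x) (snd x))
     \<le> (\<Sum>x\<in>pairs. sa_prob mu G Smax \<theta> (Suc T) x *
          (\<gamma> + h (fst x) - (\<Sum>s'\<le>Smax. trans (fst x) (snd x) s' * h s')))"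
    by (intro sum_mono mult_left_mono sa_prob_bounds) (use assms in \<open>force simp: algebra_simps\<close>)
  also have "\<dots> = \<gamma> + (\<Sum>s\<le>Smax. pmf (state_law T) s * h s) - (\<Sum>s\<le>Smax. pmf (state_law (Suc T)) s * h s)"
    using sum_sa_prob[of T]
    by (simp add: sum_pmf_state_law_Suc right_diff_distrib distrib_left sum_subtractf sum.distrib
        sum_sa_prob_fst flip: sum_distrib_right)
  finally show ?case using Suc.IH by (simp add: algebra_simps)
qed simp

end

section \<open>Stationary policies: product form, exact reward and convergence of the state
  law\<close>

locale stationary_prosumer =
  fixes mu :: "nat pmf" and G :: "int pmf" and Smax Lmax Dmax :: nat
    and \<Psi> :: "nat \<Rightarrow> (nat \<times> nat) pmf"
  assumes init': "set_pmf mu \<subseteq> {..Smax}"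
    and valid': "valid_stationary Smax Lmax Dmax \<Psi>"
begin

sublocale prosumer mu G Smax Lmax Dmax "stationary \<Psi>"
  by unfold_locales (use init' valid' in \<open>auto simp: valid_policy_def valid_stationary_def\<close>)

lemma sa_prob_stationary:
  "sa_prob mu G Smax (stationary \<Psi>) (Suc t) (s, a) = pmf (state_law t) s * pmf (\<Psi> s) a"
proof -
  have "sa_law mu G Smax (stationary \<Psi>) (Suc t) = bind_pmf (state_law t) (\<lambda>s. map_pmf (Pair s) (\<Psi> s))"
    by (auto simp: sa_law_def state_law_def bind_map_pmf intro!: bind_pmf_cong)
  moreover have "pmf (map_pmf (Pair s') (\<Psi> s')) (s, a) = indicator {s} s' * pmf (\<Psi> s) a" for s'
  proof (cases "s' = s")
    case True
    then show ?thesis by (simp add: pmf_map_inj' inj_on_def)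
  next
    case False
    then show ?thesis by (subst pmf_map_outside) auto
  qed
  ultimately show ?thesis
    by (simp add: sa_prob_def pmf_bind measure_pmf_single)
qed

lemma sum_sa_prob_stationary:
  "(\<Sum>x\<in>pairs. sa_prob mu G Smax (stationary \<Psi>) (Suc t) x * f (fst x) (snd x))
    = (\<Sum>s\<le>Smax. pmf (state_law t) s * (\<Sum>a\<in>feasible Smax Lmax Dmax s. pmf (\<Psi> s) a * f s a))"
proof -
  have "(\<Sum>x\<in>pairs. sa_prob mu G Smax (stationary \<Psi>) (Suc t) x * f (fst x) (snd x))
      = (\<Sum>(s, a)\<in>pairs. pmf (state_law t) s * (pmf (\<Psi> s) a * f s a))"
    by (intro sum.cong refl) (auto simp: sa_prob_stationary)
  also have "\<dots> = (\<Sum>s\<le>Smax. \<Sum>a\<in>feasible Smax Lmax Dmax s. pmf (state_law t) s * (pmf (\<Psi> s) a * f s a))"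
    by (rule sum.Sigma[symmetric]) (auto simp: finite_feasible)
  finally show ?thesis by (simp add: sum_distrib_left)
qed

text \<open>Given the state, the action has law \<open>\<Psi> s\<close>, so the Poisson equation,
  averaged over \<open>\<Psi> s\<close>, can be averaged further over the state law; the telescoping
  is then exact.\<close>

lemma sum_reward_eq:
  assumes "\<And>s. s \<le> Smax \<Longrightarrow> (\<Sum>a\<in>feasible Smax Lmax Dmax s.
      pmf (\<Psi> s) a * (r s a + (\<Sum>s'\<le>Smax. trans s a s' * h s'))) = \<gamma> + h s"
  shows "(\<Sum>t<T. \<Sum>x\<in>pairs. sa_prob mu G Smax (stationary \<Psi>) (Suc t) x * r (fst x) (snd x))
    = real T * \<gamma> + (\<Sum>s\<le>Smax. pmf (state_law 0) s * h s) - (\<Sum>s\<le>Smax. pmf (state_law T) s * h s)"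
proof (induction T)
  case (Suc T)
  have "(\<Sum>x\<in>pairs. sa_prob mu G Smax (stationary \<Psi>) (Suc T) x * r (fst x) (snd x))
      + (\<Sum>s\<le>Smax. pmf (state_law (Suc T)) s * h s)
     = (\<Sum>x\<in>pairs. sa_prob mu G Smax (stationary \<Psi>) (Suc T) x *
          (r (fst x) (snd x) + (\<Sum>s'\<le>Smax. trans (fst x) (snd x) s' * h s')))"
    by (simp add: sum_pmf_state_law_Suc distrib_left sum.distrib)
  also have "\<dots> = (\<Sum>s\<le>Smax. pmf (state_law T) s * (\<Sum>a\<in>feasible Smax Lmax Dmax s.
      pmf (\<Psi> s) a * (r s a + (\<Sum>s'\<le>Smax. trans s a s' * h s'))))"
    by (rule sum_sa_prob_stationary)
  also have "\<dots> = (\<Sum>s\<le>Smax. pmf (state_law T) s * (\<gamma> + h s))"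
    using assms by (intro sum.cong) auto
  also have "\<dots> = \<gamma> + (\<Sum>s\<le>Smax. pmf (state_law T) s * h s)"
    using sum_pmf_eq_1[OF _ set_state_law, of T]
    by (simp add: distrib_left sum.distrib flip: sum_distrib_right)
  finally show ?case using Suc.IH by (simp add: algebra_simps)
qed simp

text \<open>Doeblin's argument: subtracting the common part \<open>lam\<close> of all transition probabilities does
  not affect the image of a difference of two laws, but shrinks the kernel by \<open>1 - lam (Smax + 1)\<close>.\<close>

lemma state_law_tendsto:
  assumes lam: "0 < lam" "\<And>k. \<bar>k\<bar> \<le> int Smax \<Longrightarrow> lam \<le> pmf G k"
    and \<rho>_sum: "(\<Sum>s\<le>Smax. \<rho> s) = 1"
    and \<rho>: "\<And>s'. s' \<le> Smax \<Longrightarrow> \<rho> s' =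
      (\<Sum>s\<le>Smax. \<rho> s * (\<Sum>a\<in>feasible Smax Lmax Dmax s. pmf (\<Psi> s) a * trans s a s'))"
    and s: "s \<le> Smax"
  shows "(\<lambda>t. pmf (state_law t) s) \<longlonglongrightarrow> \<rho> s"
proof -
  define Q where "Q s s' = (\<Sum>a\<in>feasible Smax Lmax Dmax s. pmf (\<Psi> s) a * trans s a s')" for s s'
  define D where "D t s = pmf (state_law t) s - \<rho> s" for t s
  define \<beta> where "\<beta> = 1 - lam * real (Suc Smax)"
  have \<Psi>_sum: "(\<Sum>a\<in>feasible Smax Lmax Dmax s. pmf (\<Psi> s) a) = 1" if "s \<le> Smax" for s
    using valid' that by (intro sum_pmf_eq_1 finite_feasible) (auto simp: valid_stationary_def)
  have Q_ge: "lam \<le> Q s s'" if "s \<le> Smax" "s' \<le> Smax" for s s'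
  proof -
    have "(\<Sum>a\<in>feasible Smax Lmax Dmax s. pmf (\<Psi> s) a * lam) \<le> Q s s'"
      unfolding Q_def using lam that
      by (intro sum_mono mult_left_mono pmf_next_state_ge[where G = G]) auto
    then show ?thesis using \<Psi>_sum[OF that(1)] by (simp flip: sum_distrib_right)
  qed
  have Q_sum: "(\<Sum>s'\<le>Smax. Q s s') = 1" if "s \<le> Smax" for s
  proof -
    have "(\<Sum>s'\<le>Smax. Q s s') = (\<Sum>a\<in>feasible Smax Lmax Dmax s. pmf (\<Psi> s) a * (\<Sum>s'\<le>Smax. trans s a s'))"
      unfolding Q_def by (subst sum.swap) (simp add: sum_distrib_left)
    also have "\<dots> = (\<Sum>a\<in>feasible Smax Lmax Dmax s. pmf (\<Psi> s) a)"
      by (intro sum.cong refl) (subst sum_pmf_eq_1, auto simp: next_state_le)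
    finally show ?thesis using \<Psi>_sum[OF that] by simp
  qed
  have step: "pmf (state_law (Suc t)) s' = (\<Sum>s\<le>Smax. pmf (state_law t) s * Q s s')" for t s'
    unfolding pmf_state_law_Suc Q_def by (rule sum_sa_prob_stationary)
  have D_sum: "(\<Sum>s\<le>Smax. D t s) = 0" for t
    using sum_pmf_eq_1[OF _ set_state_law, of t] \<rho>_sum by (simp add: D_def sum_subtractf)
  have D_Suc: "D (Suc t) s' = (\<Sum>s\<le>Smax. D t s * (Q s s' - lam))" if "s' \<le> Smax" for t s'
  proof -
    have "D (Suc t) s' = (\<Sum>s\<le>Smax. D t s * Q s s')"
      using \<rho>[OF that] by (simp add: D_def step Q_def left_diff_distrib sum_subtractf)
    then show ?thesis using D_sum[of t]
      by (simp add: right_diff_distrib sum_subtractf flip: sum_distrib_right)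
  qed
  have contract: "(\<Sum>s\<le>Smax. \<bar>D (Suc t) s\<bar>) \<le> \<beta> * (\<Sum>s\<le>Smax. \<bar>D t s\<bar>)" for t
  proof -
    have "(\<Sum>s'\<le>Smax. \<bar>D (Suc t) s'\<bar>) \<le> (\<Sum>s'\<le>Smax. \<Sum>s\<le>Smax. \<bar>D t s\<bar> * (Q s s' - lam))"
    proof (rule sum_mono)
      fix s' assume s': "s' \<in> {..Smax}"
      have "\<bar>D (Suc t) s'\<bar> \<le> (\<Sum>s\<le>Smax. \<bar>D t s * (Q s s' - lam)\<bar>)"
        using D_Suc[of s' t] s' by (simp add: sum_abs)
      also have "\<dots> = (\<Sum>s\<le>Smax. \<bar>D t s\<bar> * (Q s s' - lam))"
        using Q_ge s' by (intro sum.cong) (auto simp: abs_mult)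
      finally show "\<bar>D (Suc t) s'\<bar> \<le> (\<Sum>s\<le>Smax. \<bar>D t s\<bar> * (Q s s' - lam))" .
    qed
    also have "\<dots> = (\<Sum>s\<le>Smax. \<bar>D t s\<bar> * (\<Sum>s'\<le>Smax. Q s s' - lam))"
      by (subst sum.swap) (simp add: sum_distrib_left)
    also have "\<dots> = (\<Sum>s\<le>Smax. \<bar>D t s\<bar> * \<beta>)"
      using Q_sum by (intro sum.cong) (auto simp: sum_subtractf \<beta>_def mult.commute)
    finally show ?thesis by (simp add: sum_distrib_left mult.commute)
  qed
  \<comment> \<open>Row 0 of \<open>Q\<close> has mass one and \<open>Smax + 1\<close> entries, each
    at least \<open>lam\<close>; hence \<open>\<beta>\<close> is not negative.\<close>
  have "(\<Sum>s'\<le>Smax. lam) \<le> (\<Sum>s'\<le>Smax. Q 0 s')" using Q_ge by (intro sum_mono) auto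
  then have \<beta>: "0 \<le> \<beta>" "\<beta> < 1"
    using Q_sum[of 0] lam by (auto simp: \<beta>_def mult.commute intro!: mult_pos_pos)
  have bound: "(\<Sum>s\<le>Smax. \<bar>D t s\<bar>) \<le> \<beta> ^ t * (\<Sum>s\<le>Smax. \<bar>D 0 s\<bar>)" for t
  proof (induction t)
    case (Suc t)
    show ?case
      using order.trans[OF contract mult_left_mono[OF Suc.IH \<beta>(1)]] by (simp add: mult.assoc)
  qed simp
  have "(\<lambda>t. \<beta> ^ t) \<longlonglongrightarrow> 0"
    using \<beta> by (intro LIMSEQ_power_zero) auto
  then have lim: "(\<lambda>t. \<beta> ^ t * (\<Sum>s\<le>Smax. \<bar>D 0 s\<bar>)) \<longlonglongrightarrow> 0"
    by (rule tendsto_mult_left_zero)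
  have "norm (D t s) \<le> \<beta> ^ t * (\<Sum>s\<le>Smax. \<bar>D 0 s\<bar>)" for t
    using order.trans[OF member_le_sum[of s "{..Smax}" "\<lambda>s. \<bar>D t s\<bar>"] bound] s by simp
  then have "eventually (\<lambda>t. norm (D t s) \<le> \<beta> ^ t * (\<Sum>s\<le>Smax. \<bar>D 0 s\<bar>)) sequentially"
    by simp
  then have "(\<lambda>t. D t s) \<longlonglongrightarrow> 0" using lim by (rule Lim_null_comparison)
  then show ?thesis unfolding D_def by (rule LIM_zero_cancel)
qed

end

section \<open>The equilibrium theorem\<close>

lemma limsup_ereal_le:
  fixes f g :: "nat \<Rightarrow> real"
  assumes "eventually (\<lambda>T. f T \<le> g T) sequentially" "g \<longlonglongrightarrow> L"
  shows "limsup (\<lambda>T. ereal (f T)) \<le> ereal L"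
proof -
  have "limsup (\<lambda>T. ereal (f T)) \<le> limsup (\<lambda>T. ereal (g T))"
    using assms(1) by (intro Limsup_mono) simp
  also have "\<dots> = ereal L"
    using assms(2) by (intro lim_imp_Limsup) auto
  finally show ?thesis .
qed

text \<open>Clipping the argument extends the weighting functions continuously to the whole line, so
  that no range conditions arise in the fixed-point argument.\<close>

definition clip :: "(real \<Rightarrow> real) \<Rightarrow> real \<Rightarrow> real" where
  "clip f t = f (max 0 (min 1 t))"

lemma clip_eq: "0 \<le> t \<Longrightarrow> t \<le> 1 \<Longrightarrow> clip f t = f t"
  by (simp add: clip_def)

lemma continuous_on_clip:
  assumes "continuous_on {0..1} f"
  shows "continuous_on UNIV (clip f)"
  unfolding clip_def
  by (rule continuous_on_compose2[OF assms]) (auto intro!: continuous_intros)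

lemma clip_bounded:
  assumes "continuous_on {0..1} f"
  obtains B where "\<And>t. \<bar>clip f t\<bar> \<le> B"
proof -
  have "bounded (f ` {0..1})"
    by (intro compact_imp_bounded compact_continuous_image assms compact_Icc)
  then obtain B where "\<And>t. t \<in> {0..1} \<Longrightarrow> \<bar>f t\<bar> \<le> B"
    unfolding bounded_iff by (metis imageI real_norm_def)
  then show ?thesis by (intro that[of B]) (auto simp: clip_def)
qed

lemma finite_state_actions: "finite (state_actions Smax Lmax Dmax)"
  by (rule finite_subset[of _ "{..Smax} \<times> {..Lmax} \<times> {..Dmax}"]) (auto simp: state_actions_def)

lemma pairs_subset_state_actions: "Sigma {..Smax} (feasible Smax Lmax Dmax) \<subseteq> state_actions Smax Lmax Dmax"
  by (auto simp: state_actions_def feasible_def)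

theorem theorem1:
  fixes N :: nat
    and Smax Lmax Dmax :: "nat \<Rightarrow> nat"
    and mu :: "nat \<Rightarrow> nat pmf"
    and G :: "nat \<Rightarrow> int pmf"
    and U :: "nat \<Rightarrow> (nat \<Rightarrow> nat \<times> nat) \<Rightarrow> real"
    and w v :: "nat \<Rightarrow> real \<Rightarrow> real"
  assumes lambda_pos: "\<forall>i<N. \<forall>k::int. \<bar>k\<bar> \<le> int (Smax i) \<longrightarrow> pmf (G i) k > 0"
    and init: "\<forall>i<N. set_pmf (mu i) \<subseteq> {..Smax i}"
    and w_cont: "\<forall>i<N. continuous_on {0..1} (w i)"
  shows "\<exists>\<Psi> :: nat \<Rightarrow> nat \<Rightarrow> (nat \<times> nat) pmf.
           (\<forall>i<N. valid_stationary (Smax i) (Lmax i) (Dmax i) (\<Psi> i)) \<and>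
           (\<forall>i<N. \<forall>\<theta>. valid_policy (Smax i) (Lmax i) (Dmax i) \<theta> \<longrightarrow>
              prospect_payoff N Smax Lmax Dmax mu G U w v i (stationary (\<Psi> i)) \<Psi>
              \<ge> prospect_payoff N Smax Lmax Dmax mu G U w v i \<theta> \<Psi>)"
proof -

  \<comment> \<open>The game with limiting rewards and its equilibrium\<close>
  define X where "X = PiE {..<N} (\<lambda>j. state_actions (Smax j) (Lmax j) (Dmax j))"
  define u where "u i x = v i (U i (restrict (\<lambda>j. snd (x j)) {..<N}))"
    for i and x :: "nat \<Rightarrow> nat \<times> nat \<times> nat"
  define F where "F \<omega> i x = clip (w i) (\<Prod>j\<in>{..<N} - {i}. \<omega> j (fst (x j)) (snd (x j))) * u i x"
    for \<omega> :: "nat \<Rightarrow> nat \<Rightarrow> nat \<times> nat \<Rightarrow> real" and i x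
  \<comment> \<open>The weighting acts only on the opponents' probabilities, so a payoff is linear
    in the player's own state-action law. Collecting the profiles with the same \<open>i\<close>-th
    component yields the coefficient, which serves as reward for the pair
    \<open>(s, a)\<close>.\<close>
  define r where "r \<omega> i s a = (\<Sum>x | x \<in> X \<and> x i = (s, a). F \<omega> i x)" for \<omega> i s a
  define lam where "lam i = Min (pmf (G i) ` {- int (Smax i)..int (Smax i)})" for i
  let ?A = "\<lambda>i. feasible (Smax i) (Lmax i) (Dmax i)"
  let ?P = "\<lambda>i s a. pmf (map_pmf (next_state (Smax i) s a) (G i))"
  have X: "finite X"
    unfolding X_def by (intro finite_PiE finite_state_actions) auto
  have lam: "0 < lam i" if "i < N" for i
    using lambda_pos that by (auto simp: lam_def Min_gr_iff abs_le_iff)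
  have lam_le: "lam i \<le> pmf (G i) k" if "\<bar>k\<bar> \<le> int (Smax i)" for i k
    unfolding lam_def using that by (intro Min_le imageI) auto
  have "\<exists>B. \<forall>t. \<bar>clip (w i) t\<bar> \<le> B" if "i < N" for i
    using clip_bounded w_cont that by metis
  then obtain B where B: "\<And>i t. i < N \<Longrightarrow> \<bar>clip (w i) t\<bar> \<le> B i" by metis
  have F_cont: "continuous_on UNIV (\<lambda>\<omega>. F \<omega> i x)" if "i < N" for i x
    unfolding F_def
    by (intro continuous_on_mult continuous_on_const continuous_on_prod
        continuous_on_compose2[OF continuous_on_clip])
       (use w_cont that in \<open>auto intro!: continuous_on_product_then_coordinatewise[OF
          continuous_on_product_then_coordinatewise[OF continuous_on_product_coordinates]]\<close>)
  have F_bound: "\<bar>F \<omega> i x\<bar> \<le> B i * \<bar>u i x\<bar>" if "i < N" for \<omega> i x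
    unfolding F_def abs_mult using B[OF that] by (intro mult_right_mono) auto
  have r_bound: "\<bar>r \<omega> i s a\<bar> \<le> (\<Sum>x\<in>X. B i * \<bar>u i x\<bar>)" if "i < N" for \<omega> i s a
  proof -
    have "\<bar>r \<omega> i s a\<bar> \<le> (\<Sum>x | x \<in> X \<and> x i = (s, a). \<bar>F \<omega> i x\<bar>)"
      unfolding r_def by (rule sum_abs)
    also have "\<dots> \<le> (\<Sum>x\<in>X. \<bar>F \<omega> i x\<bar>)"
      using X by (intro sum_mono2) auto
    also have "\<dots> \<le> (\<Sum>x\<in>X. B i * \<bar>u i x\<bar>)"
      by (intro sum_mono F_bound that)
    finally show ?thesis .
  qed
  obtain \<psi> \<rho> h \<gamma> where \<psi>_nonneg: "\<And>i s a. 0 \<le> \<psi> i s a"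
    and \<psi>_outside: "\<And>i s a. a \<notin> ?A i s \<Longrightarrow> \<psi> i s a = 0"
    and \<psi>_sum: "\<And>i s. i \<in> {..<N} \<Longrightarrow> s \<in> {..Smax i} \<Longrightarrow> (\<Sum>a\<in>?A i s. \<psi> i s a) = 1"
    and \<rho>_nonneg: "\<And>i s. 0 \<le> \<rho> i s"
    and \<rho>_sum: "\<And>i. i \<in> {..<N} \<Longrightarrow> (\<Sum>s\<le>Smax i. \<rho> i s) = 1"
    and \<rho>: "\<And>i s'. i \<in> {..<N} \<Longrightarrow> s' \<in> {..Smax i} \<Longrightarrow>
        \<rho> i s' = (\<Sum>s\<le>Smax i. \<rho> i s * (\<Sum>a\<in>?A i s. \<psi> i s a * ?P i s a s'))"
    and opt: "\<And>i s a. i \<in> {..<N} \<Longrightarrow> s \<in> {..Smax i} \<Longrightarrow> a \<in> ?A i s \<Longrightarrow>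
       r (\<lambda>i s a. \<rho> i s * \<psi> i s a) i s a + (\<Sum>s'\<le>Smax i. ?P i s a s' * h i s') \<le> \<gamma> i + h i s"
    and bellman: "\<And>i s. i \<in> {..<N} \<Longrightarrow> s \<in> {..Smax i} \<Longrightarrow>
       (\<Sum>a\<in>?A i s. \<psi> i s a * (r (\<lambda>i s a. \<rho> i s * \<psi> i s a) i s a + (\<Sum>s'\<le>Smax i. ?P i s a s' * h i s')))
       = \<gamma> i + h i s"
  proof (rule stationary_equilibrium[where I = "{..<N}" and S = "\<lambda>i. {..Smax i}" and A = ?A and P = ?P
        and r = r and lam = lam and M = "\<lambda>i. \<Sum>x\<in>X. B i * \<bar>u i x\<bar>"])
    fix i s a assume "i \<in> {..<N}"
    then show "continuous_on UNIV (\<lambda>\<omega>. r \<omega> i s a)"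
      unfolding r_def by (intro continuous_on_sum F_cont) simp
  next
    fix i s a assume "a \<in> ?A i s"
    show "(\<Sum>s'\<le>Smax i. ?P i s a s') = 1"
      by (rule sum_pmf_eq_1) (auto simp: next_state_le)
  next
    fix i s a s' assume "a \<in> ?A i s" "s' \<in> {..Smax i}"
    then show "lam i \<le> ?P i s a s'"
      by (intro pmf_next_state_ge lam_le) auto
  qed (use finite_feasible feasible_nonempty lam r_bound in auto)
  define \<omega> where "\<omega> = (\<lambda>i s a. \<rho> i s * \<psi> i s a)"
  \<comment> \<open>The guard selects the players and states of the game, where
    \<open>\<psi>\<close> is known to have mass one.\<close>
  have "\<forall>i s. \<exists>p. i < N \<and> s \<le> Smax i \<longrightarrow> pmf p = \<psi> i s"
    using pmf_with_finite_support[OF finite_feasible, of "\<psi> _ _"] \<psi>_nonneg \<psi>_outside \<psi>_sum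
    by (metis atMost_iff lessThan_iff)
  then obtain \<Psi> where \<Psi>: "\<And>i s. i < N \<Longrightarrow> s \<le> Smax i \<Longrightarrow> pmf (\<Psi> i s) = \<psi> i s" by metis
  have valid: "valid_stationary (Smax i) (Lmax i) (Dmax i) (\<Psi> i)" if "i < N" for i
    using \<Psi>[OF that] \<psi>_outside by (force simp: valid_stationary_def set_pmf_iff)
  have stationary: "stationary_prosumer (mu i) (Smax i) (Lmax i) (Dmax i) (\<Psi> i)" if "i < N" for i
    using init valid that by unfold_locales auto
  \<comment> \<open>The state law tends to \<open>\<rho>\<close> by Doeblin's argument, and the
    action factor of the product form is constant in time.\<close>
  have sa_lim: "(\<lambda>t. sa_prob (mu j) (G j) (Smax j) (stationary (\<Psi> j)) (Suc t) (s, a)) \<longlonglongrightarrow> \<omega> j s a"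
    if j: "j < N" and s: "s \<le> Smax j" for j s a
  proof -
    interpret stationary_prosumer "mu j" "G j" "Smax j" "Lmax j" "Dmax j" "\<Psi> j"
      by (rule stationary[OF j])
    have "(\<lambda>t. pmf (state_law t) s) \<longlonglongrightarrow> \<rho> j s"
      using j s lam[OF j] lam_le[of _ j] \<rho>_sum[of j] \<rho>[of j] \<Psi>[OF j]
      by (intro state_law_tendsto[of "lam j"]) auto
    then show ?thesis
      unfolding sa_prob_stationary \<omega>_def \<Psi>[OF j s] by (rule tendsto_mult_right)
  qed

  \<comment> \<open>Payoffs as averages of the limiting reward\<close>
  define q where "q i \<theta> t = sa_prob (mu i) (G i) (Smax i) \<theta> (Suc t)" for i \<theta> t
  define avg where "avg i \<theta> T = (1 / real T) * (\<Sum>t<T. \<Sum>y\<in>Sigma {..Smax i} (?A i). q i \<theta> t y * r \<omega> i (fst y) (snd y))" for i \<theta> T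
  \<comment> \<open>Replacing the opponents' laws by their limits makes an error that vanishes with
    time; so do its Cesaro averages, for any policy \<open>\<theta>\<close>.\<close>
  have payoff: "\<exists>\<epsilon>. \<epsilon> \<longlonglongrightarrow> 0 \<and> prospect_payoff N Smax Lmax Dmax mu G U w v i \<theta> \<Psi>
      = limsup (\<lambda>T. ereal (avg i \<theta> T + \<epsilon> T))"
    if i: "i < N" and \<theta>: "valid_policy (Smax i) (Lmax i) (Dmax i) \<theta>" for i \<theta>
  proof -
    interpret prosumer "mu i" "G i" "Smax i" "Lmax i" "Dmax i" \<theta>
      using init i \<theta> by unfold_locales auto
    define \<omega>t where "\<omega>t t j s a = q j (stationary (\<Psi> j)) t (s, a)" for t j s a
    define err where "err t = (\<Sum>x\<in>X. q i \<theta> t (x i) * (F (\<omega>t t) i x - F \<omega> i x))" for t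
    have F_lim: "(\<lambda>t. F (\<omega>t t) i x) \<longlonglongrightarrow> F \<omega> i x" if x: "x \<in> X" for x
    proof -
      have "(\<lambda>t. \<Prod>j\<in>{..<N} - {i}. \<omega>t t j (fst (x j)) (snd (x j)))
          \<longlonglongrightarrow> (\<Prod>j\<in>{..<N} - {i}. \<omega> j (fst (x j)) (snd (x j)))"
      proof (rule tendsto_prod)
        fix j assume j: "j \<in> {..<N} - {i}"
        then have "x j \<in> state_actions (Smax j) (Lmax j) (Dmax j)" using x by (auto simp: X_def)
        then have "fst (x j) \<le> Smax j" by (auto simp: state_actions_def)
        then show "(\<lambda>t. \<omega>t t j (fst (x j)) (snd (x j))) \<longlonglongrightarrow> \<omega> j (fst (x j)) (snd (x j))"
          unfolding \<omega>t_def q_def using j by (intro sa_lim) auto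
      qed
      then have "(\<lambda>t. clip (w i) (\<Prod>j\<in>{..<N} - {i}. \<omega>t t j (fst (x j)) (snd (x j))))
          \<longlonglongrightarrow> clip (w i) (\<Prod>j\<in>{..<N} - {i}. \<omega> j (fst (x j)) (snd (x j)))"
        by (rule continuous_on_tendsto_compose[OF continuous_on_clip[OF w_cont[rule_format, OF i]]]) auto
      then show ?thesis unfolding F_def by (rule tendsto_mult_right)
    qed
    \<comment> \<open>The player's own law need not converge: it is a factor between 0 and 1 in
      front of a term tending to 0.\<close>
    have "err \<longlonglongrightarrow> 0"
      unfolding err_def
    proof (rule tendsto_null_sum)
      fix x assume x: "x \<in> X"
      show "(\<lambda>t. q i \<theta> t (x i) * (F (\<omega>t t) i x - F \<omega> i x)) \<longlonglongrightarrow> 0"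
      proof (rule Lim_null_comparison)
        show "eventually (\<lambda>t. norm (q i \<theta> t (x i) * (F (\<omega>t t) i x - F \<omega> i x))
            \<le> \<bar>F (\<omega>t t) i x - F \<omega> i x\<bar>) sequentially"
          by (intro always_eventually)
             (auto simp: q_def abs_mult sa_prob_bounds abs_of_nonneg intro!: mult_left_le_one_le)
        show "(\<lambda>t. \<bar>F (\<omega>t t) i x - F \<omega> i x\<bar>) \<longlonglongrightarrow> 0"
          by (rule tendsto_rabs_zero[OF LIM_zero[OF F_lim[OF x]]])
      qed
    qed
    then have lim: "(\<lambda>T. (1 / real T) * (\<Sum>t<T. err t)) \<longlonglongrightarrow> 0"
      by (rule average_tendsto_zero)
    have image: "(\<lambda>x. x i) ` X \<subseteq> state_actions (Smax i) (Lmax i) (Dmax i)"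
      unfolding X_def by (rule image_subsetI, erule PiE_mem) (simp add: i)
    \<comment> \<open>The payoff sums over all state-action pairs, including infeasible ones; those
      have probability 0 under \<open>\<theta>\<close> and drop out.\<close>
    have group: "(\<Sum>x\<in>X. q i \<theta> t (x i) * F \<omega> i x)
        = (\<Sum>y\<in>pairs. q i \<theta> t y * r \<omega> i (fst y) (snd y))" for t
    proof -
      have "(\<Sum>x\<in>X. q i \<theta> t (x i) * F \<omega> i x)
          = (\<Sum>y\<in>state_actions (Smax i) (Lmax i) (Dmax i).
               \<Sum>x | x \<in> X \<and> x i = y. q i \<theta> t (x i) * F \<omega> i x)"
        by (rule sum.group[OF X finite_state_actions image, symmetric])
      also have "\<dots> = (\<Sum>y\<in>state_actions (Smax i) (Lmax i) (Dmax i). q i \<theta> t y * r \<omega> i (fst y) (snd y))"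
        by (rule sum.cong[OF refl]) (simp add: r_def sum_distrib_left)
      also have "\<dots> = (\<Sum>y\<in>pairs. q i \<theta> t y * r \<omega> i (fst y) (snd y))"
        using pairs_subset_state_actions sa_prob_outside
        by (intro sum.mono_neutral_right finite_state_actions) (auto simp: q_def)
      finally show ?thesis .
    qed
    have w_eq: "clip (w i) (\<Prod>j\<in>{..<N} - {i}. q j (stationary (\<Psi> j)) t (x j))
        = w i (\<Prod>j\<in>{..<N} - {i}. q j (stationary (\<Psi> j)) t (x j))" for t x
      by (intro clip_eq prod_nonneg prod_le_1) (auto simp: q_def sa_prob_def pmf_le_1)
    have "(1 / real T) * (\<Sum>t = 1..T. \<Sum>x\<in>X. sa_prob (mu i) (G i) (Smax i) \<theta> t (x i)
         * w i (\<Prod>j\<in>{..<N} - {i}. sa_prob (mu j) (G j) (Smax j) (stationary (\<Psi> j)) t (x j)) * u i x)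
      = avg i \<theta> T + (1 / real T) * (\<Sum>t<T. err t)" for T
    proof -
      \<comment> \<open>The shift from \<open>1..T\<close> to \<open>t < T\<close> is absorbed by
        the \<open>Suc t\<close> in \<open>q\<close>; products of probabilities lie in
        \<open>[0, 1]\<close>, where clipping changes nothing.\<close>
      have "(\<Sum>t = 1..T. \<Sum>x\<in>X. sa_prob (mu i) (G i) (Smax i) \<theta> t (x i)
         * w i (\<Prod>j\<in>{..<N} - {i}. sa_prob (mu j) (G j) (Smax j) (stationary (\<Psi> j)) t (x j)) * u i x)
        = (\<Sum>t<T. \<Sum>x\<in>X. q i \<theta> t (x i) * F (\<omega>t t) i x)"
        by (simp add: sum.atLeast1_atMost_eq F_def \<omega>t_def w_eq mult.assoc) (simp add: q_def)
      also have "\<dots> = (\<Sum>t<T. (\<Sum>y\<in>pairs. q i \<theta> t y * r \<omega> i (fst y) (snd y)) + err t)"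
        unfolding group[symmetric] err_def
        by (simp add: right_diff_distrib sum_subtractf)
      finally show ?thesis by (simp add: avg_def sum.distrib distrib_left)
    qed
    then have "prospect_payoff N Smax Lmax Dmax mu G U w v i \<theta> \<Psi>
        = limsup (\<lambda>T. ereal (avg i \<theta> T + (1 / real T) * (\<Sum>t<T. err t)))"
      unfolding prospect_payoff_def X_def[symmetric] u_def[symmetric] by simp
    with lim show ?thesis by blast
  qed

  \<comment> \<open>Comparison of deviations with the equilibrium payoff\<close>
  define Hb where "Hb i = (\<Sum>s\<le>Smax i. \<bar>h i s\<bar>)" for i
  have Hb: "\<bar>h i s\<bar> \<le> Hb i" if "s \<le> Smax i" for i s
    unfolding Hb_def using that by (intro member_le_sum[where f = "\<lambda>s. \<bar>h i s\<bar>"]) auto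
  have O_lim: "(\<lambda>T. c / real T) \<longlonglongrightarrow> 0" for c
    by (rule lim_const_over_n)
  have upper: "prospect_payoff N Smax Lmax Dmax mu G U w v i \<theta> \<Psi> \<le> ereal (\<gamma> i)"
    if i: "i < N" and \<theta>: "valid_policy (Smax i) (Lmax i) (Dmax i) \<theta>" for i \<theta>
  proof -
    interpret prosumer "mu i" "G i" "Smax i" "Lmax i" "Dmax i" \<theta>
      using init i \<theta> by unfold_locales auto
    obtain \<epsilon> where \<epsilon>: "\<epsilon> \<longlonglongrightarrow> 0" and eq: "prospect_payoff N Smax Lmax Dmax mu G U w v i \<theta> \<Psi>
      = limsup (\<lambda>T. ereal (avg i \<theta> T + \<epsilon> T))"
      using payoff[OF i \<theta>] by blast
    \<comment> \<open>Telescoping leaves two boundary terms, each of modulus at most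
      \<open>Hb i\<close>, which division by \<open>T\<close> sends to 0.\<close>
    have "avg i \<theta> T + \<epsilon> T \<le> \<gamma> i + 2 * Hb i / real T + \<epsilon> T" if T: "0 < T" for T
    proof -
      have "(\<Sum>t<T. \<Sum>y\<in>pairs. q i \<theta> t y * r \<omega> i (fst y) (snd y)) \<le> real T * \<gamma> i + 2 * Hb i"
        using sum_reward_le[of "r \<omega> i" "h i" "\<gamma> i" T] opt[of i] i
          sum_state_law_bound[of "h i" "Hb i" 0] sum_state_law_bound[of "h i" "Hb i" T] Hb[of _ i]
        by (force simp: q_def \<omega>_def abs_le_iff)
      then have "avg i \<theta> T \<le> (1 / real T) * (real T * \<gamma> i + 2 * Hb i)"
        unfolding avg_def by (intro mult_left_mono) auto
      then show ?thesis using T by (simp add: field_simps)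
    qed
    then have "eventually (\<lambda>T. avg i \<theta> T + \<epsilon> T \<le> \<gamma> i + 2 * Hb i / real T + \<epsilon> T) sequentially"
      by (intro eventually_mono[OF eventually_gt_at_top[of 0]])
    moreover have "(\<lambda>T. \<gamma> i + 2 * Hb i / real T + \<epsilon> T) \<longlonglongrightarrow> \<gamma> i + 0 + 0"
      by (intro tendsto_add tendsto_const O_lim \<epsilon>)
    ultimately show ?thesis unfolding eq add_0_right by (rule limsup_ereal_le)
  qed
  \<comment> \<open>Under the equilibrium policy the telescoping is an identity, so the averages
    converge and the limsup is their limit \<open>\<gamma> i\<close>.\<close>
  have stationary_payoff: "prospect_payoff N Smax Lmax Dmax mu G U w v i (stationary (\<Psi> i)) \<Psi> = ereal (\<gamma> i)"
    if i: "i < N" for i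
  proof -
    interpret stationary_prosumer "mu i" "G i" "Smax i" "Lmax i" "Dmax i" "\<Psi> i"
      by (rule stationary[OF i])
    obtain \<epsilon> where \<epsilon>: "\<epsilon> \<longlonglongrightarrow> 0" and eq: "prospect_payoff N Smax Lmax Dmax mu G U w v i (stationary (\<Psi> i)) \<Psi>
      = limsup (\<lambda>T. ereal (avg i (stationary (\<Psi> i)) T + \<epsilon> T))"
      using payoff[OF i valid] by blast
    define d where "d T = (\<Sum>s\<le>Smax i. pmf (state_law 0) s * h i s) - (\<Sum>s\<le>Smax i. pmf (state_law T) s * h i s)" for T
    have d: "\<bar>d T\<bar> \<le> 2 * Hb i" for T
      using sum_state_law_bound[of "h i" "Hb i" 0] sum_state_law_bound[of "h i" "Hb i" T] Hb[of _ i]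
      by (force simp: d_def abs_le_iff)
    have avg_eq: "avg i (stationary (\<Psi> i)) T = \<gamma> i + d T / real T" if T: "0 < T" for T
    proof -
      have "(\<Sum>t<T. \<Sum>y\<in>pairs. q i (stationary (\<Psi> i)) t y * r \<omega> i (fst y) (snd y)) = real T * \<gamma> i + d T"
        using sum_reward_eq[of "r \<omega> i" "h i" "\<gamma> i" T] bellman[of i] i \<Psi>[OF i]
        by (simp add: q_def \<omega>_def d_def)
      then show ?thesis using T by (simp add: avg_def field_simps)
    qed
    have "(\<lambda>T. d T / real T) \<longlonglongrightarrow> 0"
    proof (rule Lim_null_comparison[OF _ O_lim[of "2 * Hb i"]])
      show "eventually (\<lambda>T. norm (d T / real T) \<le> 2 * Hb i / real T) sequentially"
        using d by (intro always_eventually allI) (auto simp: abs_divide intro!: divide_right_mono)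
    qed
    then have "(\<lambda>T. \<gamma> i + d T / real T + \<epsilon> T) \<longlonglongrightarrow> \<gamma> i + 0 + 0"
      by (intro tendsto_add tendsto_const \<epsilon>)
    moreover have "eventually (\<lambda>T. \<gamma> i + d T / real T + \<epsilon> T = avg i (stationary (\<Psi> i)) T + \<epsilon> T) sequentially"
      using eventually_gt_at_top[of 0] by eventually_elim (simp add: avg_eq)
    ultimately have "(\<lambda>T. avg i (stationary (\<Psi> i)) T + \<epsilon> T) \<longlonglongrightarrow> \<gamma> i"
      by (simp add: Lim_transform_eventually)
    then show ?thesis unfolding eq by (intro lim_imp_Limsup) auto
  qed
  show ?thesis
    using valid upper stationary_payoff by (intro exI[of _ \<Psi>]) auto
qed

end
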